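(* Let $\alpha\in(0,1)$ and let $u$ be a smooth solution in $\mathbb{R}^n\times(0,\infty)$ of the initial value problem $$\partial_t^2 u - c^2(x)\Delta u + a(x)\partial_t^\alpha u = 0,\qquad (u,\partial_t u)|_{t=0} = \Big(f,\,-\tfrac{a(x)}{\Gamma(2-\alpha)}f\Big).$$ Then $U(x,t)=H(t)u(x,t)$ solves, in the sense of distributions, $$\partial_t^2U-c^2\Delta U+\mathcal{A}[U]=\delta'(t)\otimes f(x),\qquad U|_{t<0}=0,$$ where $\mathcal{A}[U]:=a(x)\,(U(t)*\Phi_{-\alpha}(t))$ (convolution in time).
   Context: $c,a\in C^\infty(\mathbb{R}^n)$ with $c(x)\ge c_0>0$ and $a\ge0$. $H(t)$ is the Heaviside function, $\delta'$ the derivative of the Dirac delta, $\Gamma(\cdot)$ the Gamma function. The Caputo derivative is $\partial_t^\alpha f(t)=\frac{1}{\Gamma(1-\alpha)}\int_0^t\frac{f'(s)}{(t-s)^\alpha}ds$. $\Phi_{-\alpha}$ is the tempered distribution in time, supported in $[0,\infty)$, given by $\Phi_{-\alpha}(t)=\frac{1}{\Gamma(1-\alpha)}\frac{d}{dt}\big(H(t)t^{-\alpha}\big)$ (distributional derivative), equivalently with Fourier transform $(i\omega)^\alpha$. The convolution of two distributions on $\mathbb{R}$ with supports bounded from below is the usual one, $\langle f*g,\varphi\rangle=\sum_j\langle f*(h_jg),\varphi\rangle$ for any locally finite, compactly supported smooth partition of unity $\{h_j\}$ of $\mathbb{R}$.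
   Formalization: The solution u is required to be smooth up to t=0, not only for t>0; this forces a·f=0, so the initial velocity is zero. Without it the claim fails, e.g. for positive constants a, c, f, where −af δ/Γ(2−α) + af H(t)t^{−α}/Γ(1−α) is left over. *)

theory Defs
  imports "HOL-Analysis.Analysis"
begin

section \<open>Classical calculus\<close>

text \<open>Derivatives are taken within \<open>S\<close>. For open \<open>S\<close> this is the usual class of \<open>k\<close> times
  continuously differentiable functions; for a closed half-space it is the class of functions that
  are so up to the boundary, with one-sided derivatives there. In both cases \<open>f'\<close> is unique on
  \<open>S\<close>.\<close>

primrec Ck_on :: "nat \<Rightarrow> 'a::euclidean_space set \<Rightarrow> ('a \<Rightarrow> real) \<Rightarrow> bool" where
  "Ck_on 0 S f = continuous_on S f"
| "Ck_on (Suc k) S f =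
     (\<exists>f'. (\<forall>x\<in>S. (f has_derivative f' x) (at x within S)) \<and> (\<forall>v. Ck_on k S (\<lambda>x. f' x v)))"

definition smooth_on :: "'a::euclidean_space set \<Rightarrow> ('a \<Rightarrow> real) \<Rightarrow> bool" where
  "smooth_on S f \<longleftrightarrow> (\<forall>k. Ck_on k S f)"

definition dir_deriv :: "'a::euclidean_space \<Rightarrow> ('a \<Rightarrow> real) \<Rightarrow> 'a \<Rightarrow> real" where
  "dir_deriv v g x = deriv (\<lambda>s. g (x + s *\<^sub>R v)) 0"

definition laplacian :: "('a::euclidean_space \<Rightarrow> real) \<Rightarrow> 'a \<Rightarrow> real" where
  "laplacian g x = (\<Sum>b\<in>Basis. dir_deriv b (dir_deriv b g) x)"

definition caputo :: "real \<Rightarrow> (real \<Rightarrow> real) \<Rightarrow> real \<Rightarrow> real" where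
  "caputo \<alpha> g t =
     1 / Gamma (1 - \<alpha>) * (LINT s:{0<..<t}|lborel. deriv g s / (t - s) powr \<alpha>)"

definition heaviside :: "real \<Rightarrow> real" where
  "heaviside t = (if t < 0 then 0 else 1)"

section \<open>Distributions as functionals on test functions\<close>

definition test_function :: "('a::euclidean_space \<Rightarrow> real) \<Rightarrow> bool" where
  "test_function \<phi> \<longleftrightarrow> smooth_on UNIV \<phi> \<and> compact (closure {x. \<phi> x \<noteq> 0})"

text \<open>Only the values of a functional at test functions are meaningful; in particular equality of
  distributions is equality at all test functions, \<open>dist_eq\<close> below.\<close>

type_synonym 'a functional = "('a \<Rightarrow> real) \<Rightarrow> real"

definition dist_eq :: "'a::euclidean_space functional \<Rightarrow> 'a functional \<Rightarrow> bool" where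
  "dist_eq T S \<longleftrightarrow> (\<forall>\<phi>. test_function \<phi> \<longrightarrow> T \<phi> = S \<phi>)"

definition vanishes_on :: "'a::euclidean_space set \<Rightarrow> 'a functional \<Rightarrow> bool" where
  "vanishes_on W T \<longleftrightarrow>
     (\<forall>\<phi>. test_function \<phi> \<and> closure {x. \<phi> x \<noteq> 0} \<subseteq> W \<longrightarrow> T \<phi> = 0)"

definition dist_of :: "('a::euclidean_space \<Rightarrow> real) \<Rightarrow> 'a functional" where
  "dist_of g \<phi> = (LINT x|lborel. g x * \<phi> x)"

definition dirac :: "'a::euclidean_space \<Rightarrow> 'a functional" where
  "dirac x \<phi> = \<phi> x"

definition dist_deriv :: "'a::euclidean_space \<Rightarrow> 'a functional \<Rightarrow> 'a functional" where
  "dist_deriv v T \<phi> = - T (dir_deriv v \<phi>)"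

definition dist_mult :: "('a::euclidean_space \<Rightarrow> real) \<Rightarrow> 'a functional \<Rightarrow> 'a functional" where
  "dist_mult g T \<phi> = T (\<lambda>x. g x * \<phi> x)"

definition dist_tensor ::
  "'a::euclidean_space functional \<Rightarrow> real functional \<Rightarrow> ('a \<times> real) functional" where
  "dist_tensor S T \<phi> = S (\<lambda>x. T (\<lambda>t. \<phi> (x, t)))"

definition dist_dt :: "('a::euclidean_space \<times> real) functional \<Rightarrow> ('a \<times> real) functional" where
  "dist_dt = dist_deriv (0, 1)"

definition dist_laplacian_x ::
  "('a::euclidean_space \<times> real) functional \<Rightarrow> ('a \<times> real) functional" where
  "dist_laplacian_x T \<phi> = (\<Sum>b\<in>Basis. dist_deriv (b, 0) (dist_deriv (b, 0) T) \<phi>)"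

section \<open>Convolution in time and the fractional attenuation term\<close>

text \<open>A locally finite family of nonzero functions on the real line is countable, so indexing
  by \<open>nat\<close> (padding with zeros if necessary) loses no partitions.\<close>

definition smooth_partition_of_unity :: "(nat \<Rightarrow> real \<Rightarrow> real) \<Rightarrow> bool" where
  "smooth_partition_of_unity h \<longleftrightarrow>
     (\<forall>j. test_function (h j)) \<and>
     (\<forall>j t. 0 \<le> h j t) \<and>
     (\<forall>t. \<exists>V. open V \<and> t \<in> V \<and> finite {j. \<exists>s\<in>V. h j s \<noteq> 0}) \<and>
     (\<forall>t. (\<Sum>j | h j t \<noteq> 0. h j t) = 1)"

text \<open>Convolution in the time variable of a distribution \<open>T\<close> in \<open>(x, t)\<close> with a distribution
  \<open>S\<close> in \<open>t\<close>. The \<open>j\<close>-th summand is \<open>\<langle>T * (h\<^sub>j S), \<phi>\<rangle>\<close>, where \<open>h\<^sub>j S\<close> is compactly supported.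
  If the time supports of \<open>T\<close> and \<open>S\<close> are bounded from below, only finitely many summands are
  nonzero and the sum does not depend on the partition.\<close>

definition time_conv ::
  "('a::euclidean_space \<times> real) functional \<Rightarrow> real functional \<Rightarrow> ('a \<times> real) functional" where
  "time_conv T S \<phi> =
     (THE y. \<forall>h. smooth_partition_of_unity h \<longrightarrow>
        (\<lambda>j. T (\<lambda>(x, s). dist_mult (h j) S (\<lambda>r. \<phi> (x, s + r)))) sums y)"

definition Phi_neg :: "real \<Rightarrow> real functional" where
  "Phi_neg \<alpha> \<phi> =
     1 / Gamma (1 - \<alpha>) * dist_deriv 1 (dist_of (\<lambda>t. heaviside t * t powr (- \<alpha>))) \<phi>"

definition attenuation ::
  "('a::euclidean_space \<Rightarrow> real) \<Rightarrow> real \<Rightarrow> ('a \<times> real) functional \<Rightarrow> ('a \<times> real) functional" where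
  "attenuation a \<alpha> T = dist_mult (\<lambda>(x, t). a x) (time_conv T (Phi_neg \<alpha>))"

section \<open>The initial value problem\<close>

text \<open>``Smooth solution'' means smooth up to the initial surface \<open>t = 0\<close>, with the equation holding
  for \<open>t > 0\<close>. The values of \<open>u x t\<close> for \<open>t < 0\<close> play no role; the derivative at \<open>t = 0\<close> is
  one-sided.\<close>

definition smooth_ivp_solution ::
  "(real^'n \<Rightarrow> real) \<Rightarrow> (real^'n \<Rightarrow> real) \<Rightarrow> real \<Rightarrow> (real^'n \<Rightarrow> real) \<Rightarrow> (real^'n \<Rightarrow> real)
    \<Rightarrow> (real^'n \<Rightarrow> real \<Rightarrow> real) \<Rightarrow> bool" where
  "smooth_ivp_solution c a \<alpha> f g u \<longleftrightarrow>
     smooth_on (UNIV \<times> {0..}) (\<lambda>(x, t). u x t) \<and>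
     (\<forall>x. \<forall>t>0. deriv (deriv (u x)) t - (c x)\<^sup>2 * laplacian (\<lambda>y. u y t) x
               + a x * caputo \<alpha> (u x) t = 0) \<and>
     (\<forall>x. u x 0 = f x) \<and>
     (\<forall>x. (u x has_real_derivative g x) (at 0 within {0..}))"

end

theory Submission
  imports Defs "HOL-Computational_Algebra.Polynomial" "HOL-Library.Nat_Bijection"
begin

text \<open>
  Tested against \<open>\<phi>\<close>, each term of the equation for \<open>U = H u\<close> is an integral over the half-space
  \<open>t \<ge> 0\<close> plus terms on the boundary \<open>t = 0\<close>. The half-space integrals add up to that of
  \<open>(u\<^sub>t\<^sub>t - c\<^sup>2 \<Delta>u + a \<partial>\<^sub>t\<^sup>\<alpha> u) \<phi>\<close>, which is zero, and the boundary terms have to be compared with the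
  source \<open>\<delta>' \<otimes> f\<close>. They are found as follows.

  Two integrations by parts in time give \<open>\<partial>\<^sub>t\<^sup>2 U = H u\<^sub>t\<^sub>t + \<delta> \<otimes> u\<^sub>t(0) + \<delta>' \<otimes> u(0)\<close>
  (\<open>integral_half_space_time_Green\<close>), whereas the Laplacian acts tangentially and leaves no trace on
  the boundary (\<open>integral_half_space_Green\<close>). The memory term is a double integral over the time \<open>s\<close>
  and the lag \<open>r\<close> (\<open>time_conv_Phi_neg\<close>); integration by parts in \<open>s\<close> followed by the substitution
  \<open>t = s + r\<close> produces the Caputo derivative and, as for every Riemann--Liouville derivative, a
  contribution of the initial value (\<open>fractional_integration_by_parts\<close>):
  \<open>a (U * \<Phi>\<^sub>-\<^sub>\<alpha>) = H a \<partial>\<^sub>t\<^sup>\<alpha> u + a u(0) t\<^sub>+\<^sup>-\<^sup>\<alpha> / \<Gamma>(1 - \<alpha>)\<close>.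

  Besides the desired \<open>\<delta>' \<otimes> f\<close> there remain \<open>\<delta> \<otimes> g\<close>, with \<open>g = - a f / \<Gamma>(2 - \<alpha>)\<close> the initial
  velocity, and \<open>a f t\<^sub>+\<^sup>-\<^sup>\<alpha> / \<Gamma>(1 - \<alpha>)\<close>. These do not cancel each other; each of them is zero, because
  smoothness up to \<open>t = 0\<close> is a strong compatibility condition
  (\<open>smooth_ivp_solution_compatibility\<close>). For \<open>t \<rightarrow> 0\<close> the Caputo derivative is asymptotic to
  \<open>g t\<^sup>1\<^sup>-\<^sup>\<alpha> / \<Gamma>(2 - \<alpha>)\<close>, which is not differentiable at \<open>t = 0\<close> unless \<open>g = 0\<close>, while
  \<open>a \<partial>\<^sub>t\<^sup>\<alpha> u = c\<^sup>2 \<Delta>u - u\<^sub>t\<^sub>t\<close> is smooth up to \<open>t = 0\<close> (\<open>caputo_regular_imp_zero_velocity\<close>). Hence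
  \<open>a g = 0\<close>, that is \<open>a\<^sup>2 f = 0\<close>, and so \<open>a f = 0\<close> and \<open>g = 0\<close>.
\<close>

section \<open>Functions of class \<open>C\<^sup>k\<close> and test functions\<close>

lemma Ck_on_SucI:
  assumes "\<And>x. x \<in> S \<Longrightarrow> (f has_derivative f' x) (at x within S)"
    and "\<And>v. Ck_on k S (\<lambda>x. f' x v)"
  shows "Ck_on (Suc k) S f"
  using assms by auto

lemma Ck_on_Suc_imp: "Ck_on (Suc k) S f \<Longrightarrow> Ck_on k S f"
proof (induction k arbitrary: f)
  case 0
  then show ?case by (auto intro: has_derivative_continuous_on)
next
  case (Suc k)
  then show ?case by (metis Ck_on.simps(2))
qed

lemma Ck_on_continuous: "Ck_on k S f \<Longrightarrow> continuous_on S f"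
  by (induction k) (auto simp del: Ck_on.simps(2) dest: Ck_on_Suc_imp)

lemma Ck_on_const: "Ck_on k S (\<lambda>_. c)"
  by (induction k arbitrary: c) (auto intro!: exI[of _ "\<lambda>_ _. 0"])

lemma Ck_on_add:
  "Ck_on k S f \<Longrightarrow> Ck_on k S g \<Longrightarrow> Ck_on k S (\<lambda>x. f x + g x)"
proof (induction k arbitrary: f g)
  case 0 then show ?case by (auto intro: continuous_on_add)
next
  case (Suc k)
  from Suc.prems obtain f' g' where
    "\<forall>x\<in>S. (f has_derivative f' x) (at x within S)" "\<forall>v. Ck_on k S (\<lambda>x. f' x v)"
    "\<forall>x\<in>S. (g has_derivative g' x) (at x within S)" "\<forall>v. Ck_on k S (\<lambda>x. g' x v)" by auto
  then show ?case
    by (intro Ck_on_SucI[where f' = "\<lambda>x v. f' x v + g' x v"] Suc.IH has_derivative_add) auto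
qed

lemma Ck_on_mult:
  "Ck_on k S f \<Longrightarrow> Ck_on k S g \<Longrightarrow> Ck_on k S (\<lambda>x. f x * g x)"
proof (induction k arbitrary: f g)
  case 0 then show ?case by (auto intro: continuous_on_mult)
next
  case (Suc k)
  from Suc.prems obtain f' g' where
    "\<forall>x\<in>S. (f has_derivative f' x) (at x within S)" "\<forall>v. Ck_on k S (\<lambda>x. f' x v)"
    "\<forall>x\<in>S. (g has_derivative g' x) (at x within S)" "\<forall>v. Ck_on k S (\<lambda>x. g' x v)" by auto
  then show ?case using Suc.prems[THEN Ck_on_Suc_imp]
    by (intro Ck_on_SucI[where f' = "\<lambda>x v. f x * g' x v + f' x v * g x"] Ck_on_add Suc.IH
          has_derivative_mult) auto
qed

lemma Ck_on_inverse:
  "Ck_on k S f \<Longrightarrow> (\<And>x. x \<in> S \<Longrightarrow> f x \<noteq> 0) \<Longrightarrow> Ck_on k S (\<lambda>x. inverse (f x))"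
proof (induction k)
  case 0 then show ?case by (auto intro: continuous_on_inverse)
next
  case (Suc k)
  from Suc.prems obtain f' where
    "\<forall>x\<in>S. (f has_derivative f' x) (at x within S)" "\<forall>v. Ck_on k S (\<lambda>x. f' x v)" by auto
  then show ?case using Suc Suc.prems(1)[THEN Ck_on_Suc_imp]
    by (intro Ck_on_SucI[where f' = "\<lambda>x v. - 1 * (inverse (f x) * f' x v * inverse (f x))"]
          Ck_on_mult Ck_on_const) (auto intro!: derivative_eq_intros)
qed

lemma Ck_on_affine_comp:
  assumes "bounded_linear L"
  shows "Ck_on k UNIV f \<Longrightarrow> Ck_on k UNIV (\<lambda>x. f (L x + p))"
proof (induction k arbitrary: f)
  case 0 
  have "continuous_on UNIV (\<lambda>x. L x + p)"
    using assms by (intro continuous_intros linear_continuous_on)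
  with 0 show ?case by (auto intro: continuous_on_compose2)
next
  case (Suc k)
  from Suc.prems obtain f' where
    f': "\<And>x. (f has_derivative f' x) (at x)" "\<forall>v. Ck_on k UNIV (\<lambda>x. f' x v)" by auto
  have "((\<lambda>x. L x + p) has_derivative L) (at x)" for x
    using assms by (auto intro!: derivative_eq_intros bounded_linear_imp_has_derivative)
  from has_derivative_compose[OF this f'(1)] f'(2) show ?case
    by (intro Ck_on_SucI[where f' = "\<lambda>x v. f' (L x + p) (L v)"] Suc.IH) auto
qed

lemma Ck_on_real_SucI:
  fixes f :: "real \<Rightarrow> real"
  assumes "\<And>x. (f has_real_derivative f' x) (at x)" and "Ck_on k UNIV f'"
  shows "Ck_on (Suc k) UNIV f"
  using assms by (intro Ck_on_SucI[where f' = "\<lambda>x v. f' x * v"] Ck_on_mult Ck_on_const)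
    (auto simp: has_field_derivative_def)

lemma has_derivative_dir_deriv:
  assumes "(f has_derivative f') (at x)"
  shows "((\<lambda>s. f (x + s *\<^sub>R v)) has_real_derivative f' v) (at 0)"
    and "dir_deriv v f x = f' v"
proof -
  have "((\<lambda>s. x + s *\<^sub>R v) has_derivative (\<lambda>s. s *\<^sub>R v)) (at 0)"
    by (auto intro!: derivative_eq_intros)
  moreover have "(f has_derivative f') (at (x + 0 *\<^sub>R v))" using assms by simp
  ultimately have "((\<lambda>s. f (x + s *\<^sub>R v)) has_derivative (\<lambda>s. f' (s *\<^sub>R v))) (at 0)"
    by (rule has_derivative_compose)
  also have "(\<lambda>s. f' (s *\<^sub>R v)) = (\<lambda>s. f' v * s)"
    using linear_scale[OF has_derivative_linear[OF assms]] by (auto simp: mult.commute)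
  finally show *: "((\<lambda>s. f (x + s *\<^sub>R v)) has_real_derivative f' v) (at 0)"
    by (simp add: has_field_derivative_def)
  then show "dir_deriv v f x = f' v"
    unfolding dir_deriv_def by (rule DERIV_imp_deriv)
qed

lemma Ck_on_dir_deriv:
  assumes "Ck_on (Suc k) UNIV f"
  shows "Ck_on k UNIV (dir_deriv v f)"
    and "((\<lambda>s. f (x + s *\<^sub>R v)) has_real_derivative dir_deriv v f x) (at 0)"
proof -
  obtain f' where f': "\<And>x. (f has_derivative f' x) (at x)" "\<forall>v. Ck_on k UNIV (\<lambda>x. f' x v)"
    using assms by auto
  then have "dir_deriv v f = (\<lambda>x. f' x v)"
    by (intro ext has_derivative_dir_deriv(2))
  then show "Ck_on k UNIV (dir_deriv v f)" 
    and "((\<lambda>s. f (x + s *\<^sub>R v)) has_real_derivative dir_deriv v f x) (at 0)"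
    using f' by (auto intro: has_derivative_dir_deriv(1))
qed

lemma smooth_on_mult: "smooth_on S f \<Longrightarrow> smooth_on S g \<Longrightarrow> smooth_on S (\<lambda>x. f x * g x)"
  by (auto simp: smooth_on_def intro: Ck_on_mult)

lemma test_function_mult:
  assumes "smooth_on UNIV g" "test_function \<phi>"
  shows "test_function (\<lambda>x. g x * \<phi> x)"
proof -
  have "closure {x. g x * \<phi> x \<noteq> 0} \<subseteq> closure {x. \<phi> x \<noteq> 0}"
    by (intro closure_mono) auto
  then have "compact (closure {x. g x * \<phi> x \<noteq> 0})"
    using assms(2) compact_Int_closed[of "closure {x. \<phi> x \<noteq> 0}" "closure {x. g x * \<phi> x \<noteq> 0}"]
    by (auto simp: test_function_def Int_absorb1)
  with assms show ?thesis by (auto simp: test_function_def intro: smooth_on_mult)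
qed

lemma test_function_deriv:
  assumes "test_function \<phi>"
  shows test_function_has_deriv:
      "((\<lambda>s. \<phi> (x + s *\<^sub>R v)) has_real_derivative dir_deriv v \<phi> x) (at 0)"
    and test_function_dir_deriv: "test_function (dir_deriv v \<phi>)"
proof -
  let ?K = "closure {x. \<phi> x \<noteq> 0}"
  have Ck: "Ck_on k UNIV \<phi>" for k
    using assms by (auto simp: test_function_def smooth_on_def)
  show d: "((\<lambda>s. \<phi> (x + s *\<^sub>R v)) has_real_derivative dir_deriv v \<phi> x) (at 0)" for x
    by (rule Ck_on_dir_deriv(2)[OF Ck])
  have "dir_deriv v \<phi> x = 0" if "x \<notin> ?K" for x
  proof -
    obtain \<phi>' where \<phi>': "(\<phi> has_derivative \<phi>') (at x)"
      using Ck[of "Suc 0"] unfolding Ck_on.simps(2) by (meson UNIV_I)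
    have "(\<phi> has_derivative (\<lambda>_. 0)) (at x)"
    proof (rule has_derivative_transform_within_open)
      show "((\<lambda>_. 0) has_derivative (\<lambda>_. 0)) (at x)" by simp
      show "open (- ?K)" by (intro open_Compl closed_closure)
      show "x \<in> - ?K" using that by simp
      show "0 = \<phi> y" if "y \<in> - ?K" for y
        using that subsetD[OF closure_subset, of y "{x. \<phi> x \<noteq> 0}"] by auto
    qed
    from has_derivative_dir_deriv(2)[OF this] show ?thesis by simp
  qed
  then have "closure {x. dir_deriv v \<phi> x \<noteq> 0} \<subseteq> ?K"
    by (intro closure_minimal closed_closure) blast
  then have "compact (closure {x. dir_deriv v \<phi> x \<noteq> 0})"
    using assms unfolding test_function_def
    by (meson bounded_subset closed_closure compact_eq_bounded_closed)
  then show "test_function (dir_deriv v \<phi>)"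
    unfolding test_function_def smooth_on_def using Ck_on_dir_deriv(1)[OF Ck] by blast
qed

lemma test_function_continuous: "test_function \<phi> \<Longrightarrow> continuous_on UNIV \<phi>"
  using Ck_on_continuous by (auto simp: test_function_def smooth_on_def)

lemma test_function_support:
  assumes "test_function \<phi>"
  obtains R where "R > 0" "\<And>x. norm x \<ge> R \<Longrightarrow> \<phi> x = 0"
proof -
  have "bounded {x. \<phi> x \<noteq> 0}"
    using assms bounded_subset[OF compact_imp_bounded closure_subset]
    by (auto simp: test_function_def)
  then obtain B where "B > 0" "\<And>x. \<phi> x \<noteq> 0 \<Longrightarrow> norm x \<le> B" by (auto simp: bounded_pos)
  then show ?thesis by (intro that[of "B + 1"]) force+
qed

lemma test_function_bounded:
  assumes "test_function \<phi>"
  obtains M where "M > 0" "\<And>x. \<bar>\<phi> x\<bar> \<le> M"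
proof -
  let ?K = "closure {x. \<phi> x \<noteq> 0}"
  have "compact (\<phi> ` ?K)"
    using assms continuous_on_subset[OF test_function_continuous[OF assms]]
    by (intro compact_continuous_image) (auto simp: test_function_def)
  then obtain M where "M > 0" "\<And>x. x \<in> ?K \<Longrightarrow> norm (\<phi> x) \<le> M"
    by (auto dest!: compact_imp_bounded simp: bounded_pos)
  then have M: "M > 0" "\<And>x. x \<in> ?K \<Longrightarrow> \<bar>\<phi> x\<bar> \<le> M"
    unfolding real_norm_def by blast+
  have "\<bar>\<phi> x\<bar> \<le> M" for x
  proof (cases "\<phi> x = 0")
    case True then show ?thesis using M(1) by simp
  next
    case False
    then have "x \<in> ?K" by (intro subsetD[OF closure_subset]) simp
    then show ?thesis by (rule M(2))
  qed
  with M(1) show ?thesis by (rule that)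
qed

lemma test_function_time_deriv:
  assumes "test_function \<theta>"
  shows "((\<lambda>t. \<theta> (x, t)) has_real_derivative dir_deriv (0, 1) \<theta> (x, t)) (at t)"
  using test_function_has_deriv[OF assms, of "(x, t)" "(0, 1)"]
    DERIV_shift[of "\<lambda>t. \<theta> (x, t)" "dir_deriv (0, 1) \<theta> (x, t)" 0 t]
  by (simp add: add.commute)

lemma test_function_real_deriv:
  fixes \<theta> :: "real \<Rightarrow> real"
  assumes "test_function \<theta>"
  shows "(\<theta> has_real_derivative dir_deriv 1 \<theta> t) (at t)"
  using test_function_has_deriv[OF assms, of t 1] DERIV_shift[of \<theta> "dir_deriv 1 \<theta> t" 0 t]
  by (simp add: add.commute)

lemma dir_deriv_1_eq: "(F has_real_derivative D) (at r) \<Longrightarrow> dir_deriv 1 F r = D"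
  using has_derivative_dir_deriv(2)[of F "(*) D" r 1] by (simp add: has_field_derivative_def)

section \<open>A smooth partition of unity of the real line\<close>

text \<open>The functions \<open>p (1/t) exp (-1/t)\<close>, continued by zero to \<open>t \<le> 0\<close>, with an arbitrary polynomial
  \<open>p\<close>: unlike \<open>exp (-1/t)\<close> alone, this family is closed under differentiation, which turns its
  smoothness into a one-line induction.\<close>

definition flat_exp :: "real poly \<Rightarrow> real \<Rightarrow> real" where
  "flat_exp p t = (if t > 0 then poly p (1 / t) * exp (- (1 / t)) else 0)"

lemma poly_times_exp_neg_tendsto_0:
  fixes p :: "real poly"
  shows "((\<lambda>x. poly p x * exp (- x)) \<longlongrightarrow> 0) at_top"
proof -
  have "((\<lambda>x. \<Sum>i\<le>degree p. coeff p i * (x ^ i / exp x)) \<longlongrightarrow> (\<Sum>i\<le>degree p. coeff p i * 0)) at_top"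
    by (intro tendsto_intros tendsto_power_div_exp_0)
  then show ?thesis
    by (simp add: poly_altdef exp_minus sum_distrib_right divide_inverse mult.assoc)
qed

text \<open>For \<open>t > 0\<close> the chain rule gives the factor \<open>1/t\<^sup>2\<close>, hence the polynomial \<open>X\<^sup>2 (p - p')\<close>. At
  \<open>t = 0\<close> the difference quotient is again of the form \<open>q (1/t) exp (-1/t)\<close>, with \<open>q = X p\<close>, and the
  exponential wins.\<close>

lemma flat_exp_deriv:
  "(flat_exp p has_real_derivative flat_exp ([:0, 0, 1:] * (p - pderiv p)) t) (at t)"
proof -
  consider "t < 0" | "t > 0" | "t = 0" by linarith
  then show ?thesis
  proof cases
    case 1
    show ?thesis
      by (rule has_field_derivative_transform_within_open[where f = "\<lambda>_. 0" and S = "{..<0}"])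
        (use 1 in \<open>auto simp: flat_exp_def\<close>)
  next
    case 2
    have "((\<lambda>t. poly p (1 / t) * exp (- (1 / t))) has_real_derivative
        flat_exp ([:0, 0, 1:] * (p - pderiv p)) t) (at t)"
      using 2 by (auto simp: flat_exp_def field_simps power2_eq_square
          intro!: derivative_eq_intros DERIV_chain'[OF _ poly_DERIV])
    then show ?thesis
      by (rule has_field_derivative_transform_within_open[where S = "{0<..}"])
        (use 2 in \<open>auto simp: flat_exp_def\<close>)
  next
    case 3
    have "((\<lambda>t. poly ([:0, 1:] * p) (inverse t) * exp (- inverse t)) \<longlongrightarrow> 0) (at_right 0)"
      by (rule filterlim_compose[OF poly_times_exp_neg_tendsto_0 filterlim_inverse_at_top_right])
    then have "((\<lambda>t. flat_exp p t / t) \<longlongrightarrow> 0) (at_right 0)"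
      by (rule Lim_transform_eventually)
        (auto simp: eventually_at_filter flat_exp_def divide_inverse)
    moreover have "((\<lambda>t. flat_exp p t / t) \<longlongrightarrow> 0) (at_left 0)"
      by (rule Lim_transform_eventually[OF tendsto_const])
        (auto simp: eventually_at_filter flat_exp_def)
    ultimately have "((\<lambda>t. flat_exp p t / t) \<longlongrightarrow> 0) (at 0)"
      by (simp add: filterlim_split_at_real)
    then show ?thesis
      using 3 by (simp add: has_field_derivative_iff flat_exp_def)
  qed
qed

lemma Ck_on_flat_exp: "Ck_on k UNIV (flat_exp p)"
proof (induction k arbitrary: p)
  case 0
  show ?case
    using flat_exp_deriv[of p] by (auto intro!: DERIV_continuous_on)
next
  case (Suc k)
  show ?case by (rule Ck_on_real_SucI[OF flat_exp_deriv Suc])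
qed

definition smooth_step :: "real \<Rightarrow> real" where
  "smooth_step t = flat_exp 1 t * inverse (flat_exp 1 t + flat_exp 1 (1 - t))"

lemma flat_exp_1_mono: "s \<le> t \<Longrightarrow> flat_exp 1 s \<le> flat_exp 1 t"
  by (auto simp: flat_exp_def frac_le)

lemma flat_exp_1_nonneg: "0 \<le> flat_exp 1 t"
  by (auto simp: flat_exp_def)

lemma flat_exp_1_sum_pos: "0 < flat_exp 1 t + flat_exp 1 (1 - t)"
  by (auto simp: flat_exp_def add_pos_pos)

lemma Ck_on_smooth_step: "Ck_on k UNIV smooth_step"
proof -
  have "Ck_on k UNIV (\<lambda>t::real. flat_exp 1 (- t + 1))"
    by (rule Ck_on_affine_comp[OF _ Ck_on_flat_exp]) (rule bounded_linear_minus[OF bounded_linear_ident])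
  then have "Ck_on k UNIV (\<lambda>t::real. flat_exp 1 (1 - t))" by (simp add: add.commute)
  then show ?thesis
    unfolding smooth_step_def[abs_def]
    by (intro Ck_on_mult Ck_on_inverse Ck_on_add Ck_on_flat_exp less_imp_neq[THEN not_sym]
        flat_exp_1_sum_pos)
qed

text \<open>The step is \<open>e t / (e t + e (1 - t))\<close> for the increasing function \<open>e = flat_exp 1\<close>; after
  clearing denominators the claim compares \<open>e s * e (1 - t)\<close> with \<open>e t * e (1 - s)\<close>.\<close>

lemma smooth_step_mono: "s \<le> t \<Longrightarrow> smooth_step s \<le> smooth_step t"
proof -
  assume "s \<le> t"
  then have "flat_exp 1 s * flat_exp 1 (1 - t) \<le> flat_exp 1 t * flat_exp 1 (1 - s)"
    by (intro mult_mono flat_exp_1_mono flat_exp_1_nonneg) auto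
  then have "flat_exp 1 s * (flat_exp 1 t + flat_exp 1 (1 - t))
      \<le> flat_exp 1 t * (flat_exp 1 s + flat_exp 1 (1 - s))"
    by (simp add: algebra_simps)
  then show ?thesis
    using flat_exp_1_sum_pos[of s] flat_exp_1_sum_pos[of t]
    by (simp add: smooth_step_def divide_simps)
qed

lemma smooth_step_0: "t \<le> 0 \<Longrightarrow> smooth_step t = 0"
  by (simp add: smooth_step_def flat_exp_def)

lemma smooth_step_1: "t \<ge> 1 \<Longrightarrow> smooth_step t = 1"
  by (simp add: smooth_step_def flat_exp_def)

text \<open>Differences of consecutive integer translates of the step: nonnegative by monotonicity of the
  step, and their sum over all integers telescopes to 1.\<close>

definition unit_bump :: "int \<Rightarrow> real \<Rightarrow> real" where
  "unit_bump k t = smooth_step (t - of_int k) - smooth_step (t - of_int k - 1)"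

lemma unit_bump_support:
  assumes "unit_bump k t \<noteq> 0"
  shows "of_int k < t" "t < of_int k + 2"
  using assms smooth_step_0[of "t - of_int k"] smooth_step_0[of "t - of_int k - 1"]
    smooth_step_1[of "t - of_int k"] smooth_step_1[of "t - of_int k - 1"]
  by (force simp: unit_bump_def)+

lemma test_function_unit_bump: "test_function (unit_bump k)"
proof -
  have "Ck_on m UNIV (\<lambda>t. smooth_step (t + - of_int k) + (-1) * smooth_step (t + (- of_int k - 1)))" for m
    by (intro Ck_on_add Ck_on_mult Ck_on_const Ck_on_affine_comp[OF _ Ck_on_smooth_step] bounded_linear_ident)
  then have "smooth_on UNIV (unit_bump k)"
    unfolding smooth_on_def unit_bump_def[abs_def] by (simp add: algebra_simps)
  moreover have "{t. unit_bump k t \<noteq> 0} \<subseteq> {of_int k..of_int k + 2}"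
    using unit_bump_support by force
  then have "bounded {t. unit_bump k t \<noteq> 0}"
    by (rule bounded_subset[OF bounded_closed_interval])
  ultimately show ?thesis by (auto simp: test_function_def compact_closure)
qed

text \<open>The convolution is a definite description over all partitions of unity, so it only has a
  determined value because at least one partition exists.\<close>

lemma smooth_partition_of_unity_unit_bump:
  "smooth_partition_of_unity (\<lambda>j. unit_bump (int_decode j))"
  unfolding smooth_partition_of_unity_def
proof (intro conjI allI)
  show "test_function (unit_bump (int_decode j))" for j by (rule test_function_unit_bump)
  show "0 \<le> unit_bump (int_decode j) t" for j t by (simp add: unit_bump_def smooth_step_mono)
  show "\<exists>V. open V \<and> t \<in> V \<and> finite {j. \<exists>s\<in>V. unit_bump (int_decode j) s \<noteq> 0}" for t
  proof (intro exI[of _ "{t - 1<..<t + 1}"] conjI)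
    have "{j. \<exists>s\<in>{t - 1<..<t + 1}. unit_bump (int_decode j) s \<noteq> 0}
        \<subseteq> int_encode ` {\<lfloor>t\<rfloor> - 4..\<lfloor>t\<rfloor> + 4}"
    proof
      fix j assume "j \<in> {j. \<exists>s\<in>{t - 1<..<t + 1}. unit_bump (int_decode j) s \<noteq> 0}"
      then obtain s where "t - 1 < s" "s < t + 1" "unit_bump (int_decode j) s \<noteq> 0" by auto
      with unit_bump_support[of "int_decode j" s]
      have "int_decode j \<in> {\<lfloor>t\<rfloor> - 4..\<lfloor>t\<rfloor> + 4}" by (simp, linarith)
      then show "j \<in> int_encode ` {\<lfloor>t\<rfloor> - 4..\<lfloor>t\<rfloor> + 4}" by (metis image_eqI int_decode_inverse)
    qed
    then show "finite {j. \<exists>s\<in>{t - 1<..<t + 1}. unit_bump (int_decode j) s \<noteq> 0}"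
      by (rule finite_subset) simp
  qed auto
  show "(\<Sum>j | unit_bump (int_decode j) t \<noteq> 0. unit_bump (int_decode j) t) = 1" for t
  proof -
    let ?A = "{\<lfloor>t\<rfloor> - 1, \<lfloor>t\<rfloor>}"
    have "(\<Sum>j | unit_bump (int_decode j) t \<noteq> 0. unit_bump (int_decode j) t)
        = (\<Sum>j\<in>int_encode ` ?A. unit_bump (int_decode j) t)"
    proof (rule sum.mono_neutral_left)
      show "{j. unit_bump (int_decode j) t \<noteq> 0} \<subseteq> int_encode ` ?A"
      proof
        fix j assume "j \<in> {j. unit_bump (int_decode j) t \<noteq> 0}"
        with unit_bump_support[of "int_decode j" t]
        have "int_decode j = \<lfloor>t\<rfloor> - 1 \<or> int_decode j = \<lfloor>t\<rfloor>" by (simp, linarith)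
        then have "int_decode j \<in> ?A" by auto
        then show "j \<in> int_encode ` ?A" by (metis image_eqI int_decode_inverse)
      qed
    qed auto
    also have "\<dots> = (\<Sum>k\<in>?A. unit_bump k t)"
      by (subst sum.reindex[OF inj_int_encode]) (simp only: o_def int_encode_inverse)
    also have "\<dots> = smooth_step (t - of_int \<lfloor>t\<rfloor> + 1) - smooth_step (t - of_int \<lfloor>t\<rfloor> - 1)"
      by (simp add: unit_bump_def algebra_simps)
    also have "\<dots> = 1"
      by (subst smooth_step_0, linarith, subst smooth_step_1) auto
    finally show ?thesis .
  qed
qed

section \<open>Integrals of cut-off functions and of the fractional kernel\<close>

text \<open>The function \<open>t\<^sub>+\<^sup>-\<^sup>\<alpha>\<close>. Up to the factor \<open>1 / \<Gamma>(1 - \<alpha>)\<close>, the distribution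
  \<open>\<Phi>\<^sub>-\<^sub>\<alpha>\<close> is its derivative.\<close>

definition frac_kernel :: "real \<Rightarrow> real \<Rightarrow> real" where
  "frac_kernel \<alpha> r = heaviside r * r powr (- \<alpha>)"

lemma heaviside_measurable [measurable]: "heaviside \<in> borel_measurable borel"
  unfolding heaviside_def[abs_def] by measurable

lemma frac_kernel_measurable [measurable]: "frac_kernel \<alpha> \<in> borel_measurable borel"
  unfolding frac_kernel_def[abs_def] by measurable

lemma frac_kernel_nonneg: "0 \<le> frac_kernel \<alpha> r"
  by (simp add: frac_kernel_def heaviside_def)

lemma frac_kernel_eq_0: "r \<le> 0 \<Longrightarrow> frac_kernel \<alpha> r = 0"
  by (auto simp: frac_kernel_def heaviside_def)

lemma frac_kernel_integral:
  assumes "\<alpha> < 1" "0 \<le> R"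
  shows "has_bochner_integral lborel (\<lambda>r. indicator {0..R} r * frac_kernel \<alpha> r)
    (R powr (1 - \<alpha>) / (1 - \<alpha>))"
proof -
  have "((\<lambda>r. r powr (- \<alpha>)) has_integral (R powr (- \<alpha> + 1) / (- \<alpha> + 1))) {0..R}"
    using assms by (intro has_integral_powr_from_0) auto
  then have "integral\<^sup>N lborel (\<lambda>r. indicator {0..R} r * r powr (- \<alpha>))
      = ennreal (R powr (- \<alpha> + 1) / (- \<alpha> + 1))"
    by (intro nn_integral_has_integral_lebesgue) auto
  moreover have "indicator {0..R} r * r powr (- \<alpha>) = indicator {0..R} r * frac_kernel \<alpha> r" for r
    by (auto simp: indicator_def frac_kernel_def heaviside_def)
  ultimately show ?thesis
    using assms
    by (intro has_bochner_integral_nn_integral) (auto simp: frac_kernel_nonneg add.commute)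
qed

lemma integrable_bounded_support:
  fixes F :: "'a::euclidean_space \<Rightarrow> real"
  assumes "F \<in> borel_measurable borel" "\<And>z. \<bar>F z\<bar> \<le> M" "\<And>z. norm z \<ge> R \<Longrightarrow> F z = 0"
  shows "integrable lborel F"
proof (rule Bochner_Integration.integrable_bound)
  show "integrable lborel (\<lambda>z::'a. indicator (cball 0 R) z * M)"
    using emeasure_compact_finite[OF compact_cball] by (auto intro!: integrable_real_indicator)
  show "AE z in lborel. norm (F z) \<le> norm (indicator (cball 0 R) z * M)"
  proof (intro always_eventually allI)
    fix z
    show "norm (F z) \<le> norm (indicator (cball 0 R) z * M)"
      using assms(2)[of z] assms(3)[of z] by (cases "norm z \<le> R") auto
  qed
qed (use assms(1) in simp)

text \<open>The integrability that allows interchanging the order of integration in time and lag: the kernel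
  is locally integrable because \<open>\<alpha> < 1\<close>, and boundedness and support of the other factor matter only for
  \<open>r > 0\<close>, since the kernel vanishes elsewhere.\<close>

lemma integrable_frac_kernel_mult:
  fixes F :: "'a::euclidean_space \<Rightarrow> real \<Rightarrow> real"
  assumes [measurable]: "case_prod F \<in> borel_measurable (borel \<Otimes>\<^sub>M borel)"
    and \<alpha>: "\<alpha> < 1"
    and bound: "\<And>z r. r > 0 \<Longrightarrow> \<bar>F z r\<bar> \<le> M"
    and supp: "\<And>z r. r > 0 \<Longrightarrow> F z r \<noteq> 0 \<Longrightarrow> norm z \<le> R \<and> r \<le> R"
  shows "integrable (lborel \<Otimes>\<^sub>M lborel) (\<lambda>(z, r). frac_kernel \<alpha> r * F z r)"
proof (cases "0 \<le> R")
  case True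
  have M: "0 \<le> M" using order_trans[OF abs_ge_zero bound[of 1]] by simp
  let ?k = "\<lambda>r. indicator {0..R} r * frac_kernel \<alpha> r"
  let ?d = "\<lambda>(z::'a, r). (M * indicator (cball 0 R) z) * ?k r"
  have k: "integrable lborel ?k"
    using frac_kernel_integral[OF \<alpha> True] by (simp add: has_bochner_integral_iff)
  have c: "integrable lborel (\<lambda>z::'a. indicator (cball 0 R) z :: real)"
    using emeasure_compact_finite[OF compact_cball] by (auto intro!: integrable_real_indicator)
  have "integrable (lborel \<Otimes>\<^sub>M lborel) ?d"
  proof (rule lborel_pair.Fubini_integrable)
    have [measurable]: "cball (0::'a) R \<in> sets borel" by simp
    show "?d \<in> borel_measurable (lborel \<Otimes>\<^sub>M lborel)"
      unfolding lborel_prod measurable_lborel2 borel_prod[symmetric] by measurable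
    show "integrable lborel (\<lambda>z. \<integral>r. norm (?d (z, r)) \<partial>lborel)"
      using c M by (simp add: abs_mult frac_kernel_nonneg)
    show "AE z in lborel. integrable lborel (\<lambda>r. ?d (z, r))"
      using k by simp
  qed
  then show ?thesis
  proof (rule Bochner_Integration.integrable_bound)
    show "AE q in lborel \<Otimes>\<^sub>M lborel. norm (case q of (z, r) \<Rightarrow> frac_kernel \<alpha> r * F z r) \<le> norm (?d q)"
    proof (intro always_eventually allI, clarify)
      fix z r
      show "norm (frac_kernel \<alpha> r * F z r) \<le> norm (M * indicator (cball 0 R) z * ?k r)"
      proof (cases "r > 0 \<and> F z r \<noteq> 0")
        case True
        with supp[of r z] bound[of r z] M show ?thesis
          by (simp add: abs_mult frac_kernel_nonneg mult.commute[of M] mult_left_mono)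
      next
        case False
        then show ?thesis by (auto simp: frac_kernel_eq_0)
      qed
    qed
  next
    show "(\<lambda>(z, r). frac_kernel \<alpha> r * F z r) \<in> borel_measurable (lborel \<Otimes>\<^sub>M lborel)"
      unfolding lborel_prod measurable_lborel2 borel_prod[symmetric] by measurable
  qed
next
  case False
  have "frac_kernel \<alpha> r * F z r = 0" for z r
    using supp[of r z] False norm_ge_zero[of z] frac_kernel_eq_0[of r \<alpha>] by fastforce
  then have "(\<lambda>(z, r). frac_kernel \<alpha> r * F z r) = (\<lambda>_. 0)" unfolding fun_eq_iff by auto
  then show ?thesis by simp
qed

text \<open>The measure-preserving substitution \<open>t = s + r\<close>, which turns a double integral over the lag \<open>r\<close>
  into a convolution integral at the time \<open>t\<close>.\<close>

lemma lborel_shear: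
  fixes g :: "real \<Rightarrow> real \<Rightarrow> real"
  assumes g: "integrable (lborel \<Otimes>\<^sub>M lborel) (case_prod g)"
    and [measurable]: "case_prod g \<in> borel_measurable (borel \<Otimes>\<^sub>M borel)"
  shows "(\<integral>s. (\<integral>r. g s r \<partial>lborel) \<partial>lborel) = (\<integral>t. (\<integral>s. g s (t - s) \<partial>lborel) \<partial>lborel)"
proof -
  have shift: "(\<integral>t. h (t - s) \<partial>lborel) = (\<integral>r. h r \<partial>lborel)" for h :: "real \<Rightarrow> real" and s
    using lborel_integral_real_affine[of 1 h "- s"] by simp
  have shift_int: "integrable lborel (\<lambda>t. h (t - s))" if "integrable lborel h"
    for h :: "real \<Rightarrow> real" and s
    using lborel_integrable_real_affine[OF that, of 1 "- s"] by simp
  have "integrable (lborel \<Otimes>\<^sub>M lborel) (\<lambda>(s, t). g s (t - s))"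
  proof (rule lborel_pair.Fubini_integrable)
    show "(\<lambda>(s, t). g s (t - s)) \<in> borel_measurable (lborel \<Otimes>\<^sub>M lborel)"
      unfolding lborel_prod measurable_lborel2 borel_prod[symmetric] by measurable
    show "integrable lborel (\<lambda>s. \<integral>t. norm (case (s, t) of (s, t) \<Rightarrow> g s (t - s)) \<partial>lborel)"
      using lborel_pair.integrable_fst'[OF integrable_norm[OF g]]
      by (simp add: shift[of "\<lambda>r. \<bar>g _ r\<bar>"])
    show "AE s in lborel. integrable lborel (\<lambda>t. case (s, t) of (s, t) \<Rightarrow> g s (t - s))"
      using lborel_pair.AE_integrable_fst'[OF g] by eventually_elim (simp add: shift_int)
  qed
  from lborel_pair.Fubini_integral[OF this] show ?thesis by (simp add: shift)
qed

text \<open>Integration by parts without coordinates. By translation invariance of Lebesgue measure the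
  difference quotients of \<open>F\<close> in direction \<open>v\<close> have integral zero; by the mean value theorem they
  are bounded by \<open>M\<close> on a fixed ball, so dominated convergence passes this on to the derivative.
  Only differentiability along \<open>v\<close> enters. Hence \<open>F\<close> may jump in other directions, as functions cut
  off at \<open>t = 0\<close> do.\<close>

lemma integral_dir_deriv_eq_0:
  fixes F D :: "'a::euclidean_space \<Rightarrow> real"
  assumes [measurable]: "F \<in> borel_measurable borel" "D \<in> borel_measurable borel"
    and deriv: "\<And>z. ((\<lambda>s. F (z + s *\<^sub>R v)) has_real_derivative D z) (at 0)"
    and F: "\<And>z. \<bar>F z\<bar> \<le> M" "\<And>z. norm z \<ge> R \<Longrightarrow> F z = 0"
    and D: "\<And>z. \<bar>D z\<bar> \<le> M" "\<And>z. norm z \<ge> R \<Longrightarrow> D z = 0"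
  shows "(\<integral>z. D z \<partial>lborel) = 0"
proof -
  \<comment> \<open>step sizes of the difference quotients\<close>
  define \<epsilon> :: "nat \<Rightarrow> real" where "\<epsilon> n = inverse (real (Suc n))" for n
  have \<epsilon>: "0 < \<epsilon> n" "\<epsilon> n \<le> 1" for n by (auto simp: \<epsilon>_def field_simps)
  define Q where "Q n z = (F (z + \<epsilon> n *\<^sub>R v) - F z) / \<epsilon> n" for n z
  have F_int: "integrable lborel F" using F by (intro integrable_bounded_support) auto
  have shift: "integrable lborel (\<lambda>z. F (z + w))" "(\<integral>z. F (z + w) \<partial>lborel) = (\<integral>z. F z \<partial>lborel)" for w
  proof -
    have "integrable (distr lborel borel ((+) w)) F"
      "integral\<^sup>L (distr lborel borel ((+) w)) F = integral\<^sup>L lborel F"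
      using F_int by (simp_all add: lborel_distr_plus)
    then show "integrable lborel (\<lambda>z. F (z + w))" "(\<integral>z. F (z + w) \<partial>lborel) = (\<integral>z. F z \<partial>lborel)"
      by (simp_all add: integrable_distr_eq integral_distr add.commute)
  qed
  have Q0: "(\<integral>z. Q n z \<partial>lborel) = 0" for n
    unfolding Q_def using shift F_int by simp
  have mvt: "\<exists>y. Q n z = D y \<and> norm (y - z) \<le> norm v" for n z
  proof -
    have d: "((\<lambda>s. F (z + s *\<^sub>R v)) has_real_derivative D (z + s *\<^sub>R v)) (at s)" for s
    proof -
      have "((\<lambda>h. F ((z + s *\<^sub>R v) + h *\<^sub>R v)) has_real_derivative D (z + s *\<^sub>R v)) (at 0)"
        by (rule deriv)
      then show ?thesis
        using DERIV_shift[of "\<lambda>s. F (z + s *\<^sub>R v)" "D (z + s *\<^sub>R v)" 0 s]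
        by (simp add: algebra_simps)
    qed
    obtain \<xi> where "0 < \<xi>" "\<xi> < \<epsilon> n"
      "F (z + \<epsilon> n *\<^sub>R v) - F (z + 0 *\<^sub>R v) = (\<epsilon> n - 0) * D (z + \<xi> *\<^sub>R v)"
      using MVT2[of 0 "\<epsilon> n" "\<lambda>s. F (z + s *\<^sub>R v)" "\<lambda>s. D (z + s *\<^sub>R v)"] \<epsilon> d by blast
    then show ?thesis using \<epsilon>[of n]
      by (intro exI[of _ "z + \<xi> *\<^sub>R v"]) (auto simp: Q_def intro!: mult_left_le_one_le)
  qed
  have "(\<lambda>n. \<integral>z. Q n z \<partial>lborel) \<longlonglongrightarrow> (\<integral>z. D z \<partial>lborel)"
  proof (rule integral_dominated_convergence)
    show "integrable lborel (\<lambda>z::'a. indicator (cball 0 (R + norm v)) z * M)"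
      using emeasure_compact_finite[OF compact_cball] by (auto intro!: integrable_real_indicator)
    show "AE z in lborel. norm (Q n z) \<le> indicator (cball 0 (R + norm v)) z * M" for n
    proof (intro always_eventually allI)
      fix z
      obtain y where y: "Q n z = D y" "norm (y - z) \<le> norm v" using mvt by blast
      have "norm z \<le> norm y + norm (y - z)" by (metis norm_minus_commute norm_triangle_sub)
      then show "norm (Q n z) \<le> indicator (cball 0 (R + norm v)) z * M"
        using y D(1)[of y] D(2)[of y] by (cases "norm y \<ge> R") (auto simp: indicator_def)
    qed
    show "AE z in lborel. (\<lambda>n. Q n z) \<longlonglongrightarrow> D z"
    proof (intro always_eventually allI)
      fix z
      have "((\<lambda>h. (F (z + h *\<^sub>R v) - F z) / h) \<longlongrightarrow> D z) (at 0)"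
        using deriv[of z] by (simp add: has_field_derivative_iff)
      moreover have "filterlim \<epsilon> (at 0) sequentially"
        unfolding filterlim_at
      proof
        show "eventually (\<lambda>n. \<epsilon> n \<in> UNIV \<and> \<epsilon> n \<noteq> 0) sequentially"
          by (simp add: \<epsilon>_def)
        show "\<epsilon> \<longlonglongrightarrow> 0" unfolding \<epsilon>_def[abs_def] by (rule LIMSEQ_inverse_real_of_nat)
      qed
      ultimately show "(\<lambda>n. Q n z) \<longlonglongrightarrow> D z"
        unfolding Q_def by (rule filterlim_compose)
    qed
  qed (simp, unfold Q_def, measurable)
  then show ?thesis by (simp add: Q0 LIMSEQ_const_iff)
qed

text \<open>Functions that are only controlled on the closed half-space, such as a solution of the initial
  value problem, become measurable, locally bounded functions after multiplication by the Heaviside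
  function.\<close>

lemma borel_measurable_heaviside_mult:
  fixes k :: "'a::euclidean_space \<times> real \<Rightarrow> real"
  assumes "continuous_on (UNIV \<times> {0..}) k"
  shows "(\<lambda>z. heaviside (snd z) * k z) \<in> borel_measurable borel"
proof -
  have "(\<lambda>z. indicator (UNIV \<times> {0..}) z *\<^sub>R k z) \<in> borel_measurable borel"
    using assms by (intro borel_measurable_continuous_on_indicator) (auto intro: borel_closed closed_Times)
  also have "(\<lambda>z. indicator (UNIV \<times> {0..}) z *\<^sub>R k z) = (\<lambda>z. heaviside (snd z) * k z)"
    by (auto simp: heaviside_def indicator_def fun_eq_iff)
  finally show ?thesis .
qed

lemma half_space_bound:
  fixes k :: "'a::euclidean_space \<times> real \<Rightarrow> real"
  assumes "continuous_on (UNIV \<times> {0..}) k"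
  obtains M where "M > 0" "\<And>z. norm z \<le> R \<Longrightarrow> \<bar>heaviside (snd z) * k z\<bar> \<le> M"
proof -
  let ?K = "cball 0 R \<inter> UNIV \<times> {0..}"
  have "compact (k ` ?K)"
    using assms
    by (intro compact_continuous_image compact_Int_closed) (auto intro: continuous_on_subset closed_Times)
  then obtain M where "M > 0" "\<And>z. z \<in> ?K \<Longrightarrow> norm (k z) \<le> M"
    by (auto dest!: compact_imp_bounded simp: bounded_pos)
  then show ?thesis
    by (intro that[of M]) (auto simp: heaviside_def)
qed

lemma
  fixes k \<theta> :: "'a::euclidean_space \<times> real \<Rightarrow> real"
  assumes k: "continuous_on (UNIV \<times> {0..}) k" and \<theta>: "test_function \<theta>"
  shows heaviside_test_function_measurable:
      "(\<lambda>z. heaviside (snd z) * k z * \<theta> z) \<in> borel_measurable borel"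
    and heaviside_test_function_bound:
      "\<exists>M. \<forall>z. \<bar>heaviside (snd z) * k z * \<theta> z\<bar> \<le> M"
    and heaviside_test_function_integrable:
      "integrable lborel (\<lambda>z. heaviside (snd z) * k z * \<theta> z)"
proof -
  note [measurable] = borel_measurable_heaviside_mult[OF k]
    borel_measurable_continuous_onI[OF test_function_continuous[OF \<theta>]]
  show m: "(\<lambda>z. heaviside (snd z) * k z * \<theta> z) \<in> borel_measurable borel" by measurable
  obtain R where R: "\<And>z. norm z \<ge> R \<Longrightarrow> \<theta> z = 0" using \<theta> by (rule test_function_support) blast
  obtain N where N: "\<And>z. \<bar>\<theta> z\<bar> \<le> N" using \<theta> by (rule test_function_bounded) blast
  obtain M where M: "M > 0" "\<And>z. norm z \<le> R \<Longrightarrow> \<bar>heaviside (snd z) * k z\<bar> \<le> M"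
    using half_space_bound[OF k] by blast
  have b: "\<bar>heaviside (snd z) * k z * \<theta> z\<bar> \<le> M * N" for z
  proof (cases "norm z \<ge> R")
    case True then show ?thesis using R M(1) order_trans[OF abs_ge_zero N[of z]] by simp
  next
    case False
    then show ?thesis
      unfolding abs_mult[of _ "\<theta> z"] using M N by (intro mult_mono) auto
  qed
  then show "\<exists>M. \<forall>z. \<bar>heaviside (snd z) * k z * \<theta> z\<bar> \<le> M" by blast
  show "integrable lborel (\<lambda>z. heaviside (snd z) * k z * \<theta> z)"
    using m b R by (intro integrable_bounded_support[where R = R]) auto
qed

lemma half_line_measurable:
  "continuous_on {0..} k \<Longrightarrow> (\<lambda>s. heaviside s * k s) \<in> borel_measurable borel"
proof -
  assume "continuous_on {0..} k"
  then have "(\<lambda>z. indicator {0..} z *\<^sub>R k z) \<in> borel_measurable borel"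
    by (intro borel_measurable_continuous_on_indicator) auto
  also have "(\<lambda>z. indicator {0..} z *\<^sub>R k z) = (\<lambda>z. heaviside z * k z)"
    by (auto simp: heaviside_def indicator_def fun_eq_iff)
  finally show ?thesis .
qed

lemma half_line_bound:
  assumes "continuous_on {0..} k"
  obtains M where "M > 0" "\<And>s::real. s \<le> R \<Longrightarrow> \<bar>heaviside s * k s :: real\<bar> \<le> M"
proof -
  have "compact (k ` {0..R})"
    using assms by (intro compact_continuous_image) (auto intro: continuous_on_subset)
  then obtain M where "M > 0" "\<And>s. s \<in> {0..R} \<Longrightarrow> norm (k s) \<le> M"
    by (auto dest!: compact_imp_bounded simp: bounded_pos)
  then show ?thesis
    by (intro that[of M]) (auto simp: heaviside_def)
qed

lemma half_line_integrable:
  assumes k: "continuous_on {0..} k" and R: "\<And>s. s \<ge> R \<Longrightarrow> k s = 0"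
  shows "integrable lborel (\<lambda>s. heaviside s * k s :: real)"
proof -
  obtain M where M: "M > 0" "\<And>s::real. s \<le> R \<Longrightarrow> \<bar>heaviside s * k s\<bar> \<le> M"
    using half_line_bound[OF k] by blast
  have "\<bar>heaviside s * k s\<bar> \<le> M" for s using M(1) M(2)[of s] R[of s] by (cases "s \<le> R") auto
  moreover have "heaviside s * k s = 0" if "norm s \<ge> R" for s
    using that R[of s] by (auto simp: heaviside_def)
  ultimately show ?thesis
    by (intro integrable_bounded_support half_line_measurable k)
qed

lemma half_line_FTC:
  fixes F F' :: "real \<Rightarrow> real"
  assumes F: "\<And>t. t \<ge> 0 \<Longrightarrow> (F has_real_derivative F' t) (at t within {0..})"
    and F': "continuous_on {0..} F'"
    and R: "\<And>t. t \<ge> R \<Longrightarrow> F t = 0" "\<And>t. t \<ge> R \<Longrightarrow> F' t = 0"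
  shows "(\<integral>t. heaviside t * F' t \<partial>lborel) = - F 0"
proof -
  let ?R = "max R 0"
  have "(\<integral>t. heaviside t * F' t \<partial>lborel) = (\<integral>t. indicator {0..?R} t *\<^sub>R F' t \<partial>lborel)"
    using R by (intro Bochner_Integration.integral_cong) (auto simp: heaviside_def indicator_def)
  also have "\<dots> = F ?R - F 0"
  proof (rule integral_FTC_atLeastAtMost)
    show "(F has_vector_derivative F' t) (at t within {0..?R})" if "0 \<le> t" "t \<le> ?R" for t
      using F[OF that(1)] has_real_derivative_iff_has_vector_derivative
      by (auto intro: has_vector_derivative_within_subset)
    show "continuous_on {0..?R} F'" by (rule continuous_on_subset[OF F']) auto
  qed simp
  finally show ?thesis using R(1)[of ?R] by simp
qed

lemma lborel_integral_time_slices: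
  fixes g :: "'a::euclidean_space \<times> real \<Rightarrow> real"
  assumes "integrable lborel g"
  shows "integrable lborel (\<lambda>x. \<integral>t. g (x, t) \<partial>lborel)"
    and "(\<integral>z. g z \<partial>lborel) = (\<integral>x. (\<integral>t. g (x, t) \<partial>lborel) \<partial>lborel)"
  using lborel_pair.integrable_fst'[of g] lborel_pair.integral_fst'[of g] assms
  by (simp_all add: lborel_prod)

section \<open>The Riemann--Liouville and the Caputo derivative\<close>

text \<open>In terms of distributions on the line:
  \<open>(H v) * (t\<^sub>+\<^sup>-\<^sup>\<alpha>)' = v(0) t\<^sub>+\<^sup>-\<^sup>\<alpha> + \<integral>\<^sub>0\<^sup>t v'(s) (t - s)\<^sup>-\<^sup>\<alpha> ds\<close>, tested against \<open>- \<theta>\<close>. That is, up to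
  the factor \<open>1 / \<Gamma>(1 - \<alpha>)\<close>, the Riemann--Liouville derivative is the Caputo derivative plus a
  contribution of the initial value.
  The singular convolution integral is never differentiated: for fixed lag \<open>r\<close> the integration by
  parts happens in \<open>s\<close>, where the integrand is continuously differentiable up to \<open>s = 0\<close>.\<close>

lemma fractional_integration_by_parts:
  fixes v p \<theta> \<theta>' :: "real \<Rightarrow> real"
  assumes \<alpha>: "\<alpha> < 1"
    and v: "\<And>s. s \<ge> 0 \<Longrightarrow> (v has_real_derivative p s) (at s within {0..})"
    and p: "continuous_on {0..} p"
    and \<theta>: "\<And>t. (\<theta> has_real_derivative \<theta>' t) (at t)"
    and \<theta>': "continuous_on UNIV \<theta>'"
    and R: "\<And>t. \<bar>t\<bar> \<ge> R \<Longrightarrow> \<theta> t = 0" "\<And>t. \<bar>t\<bar> \<ge> R \<Longrightarrow> \<theta>' t = 0"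
    and N: "\<And>t. \<bar>\<theta> t\<bar> \<le> N" "\<And>t. \<bar>\<theta>' t\<bar> \<le> N"
  shows "(\<integral>s. heaviside s * v s * (\<integral>r. frac_kernel \<alpha> r * \<theta>' (s + r) \<partial>lborel) \<partial>lborel)
    = - (v 0 * (\<integral>r. frac_kernel \<alpha> r * \<theta> r \<partial>lborel))
      - (\<integral>t. heaviside t * \<theta> t * (LINT s:{0<..<t}|lborel. p s / (t - s) powr \<alpha>) \<partial>lborel)"
proof -
  have v_cont: "continuous_on {0..} v" using v by (intro DERIV_continuous_on) auto
  have \<theta>_cont: "continuous_on UNIV \<theta>" using \<theta> by (intro DERIV_continuous_on) auto
  have N0: "0 \<le> N" using order_trans[OF abs_ge_zero N(1)] .
  note [measurable] = borel_measurable_continuous_onI[OF \<theta>_cont]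
    borel_measurable_continuous_onI[OF \<theta>'] half_line_measurable[OF v_cont] half_line_measurable[OF p]

  have joint: "integrable (lborel \<Otimes>\<^sub>M lborel)
      (\<lambda>(s, r). frac_kernel \<alpha> r * (heaviside s * w s * \<kappa> (s + r)))"
    if w: "continuous_on {0..} w" and [measurable]: "\<kappa> \<in> borel_measurable borel"
      and \<kappa>: "\<And>t. \<bar>t\<bar> \<ge> R \<Longrightarrow> \<kappa> t = 0" "\<And>t. \<bar>\<kappa> t\<bar> \<le> N" for w \<kappa> :: "real \<Rightarrow> real"
  proof -
    note [measurable] = half_line_measurable[OF w]
    obtain M where M: "M > 0" "\<And>s. s \<le> R \<Longrightarrow> \<bar>heaviside s * w s\<bar> \<le> M"
      using half_line_bound[OF w] by blast
    have supp: "0 \<le> s \<and> s + r < R" if "heaviside s * w s * \<kappa> (s + r) \<noteq> 0" "r > 0" for s r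
      using that \<kappa>(1)[of "s + r"] by (force simp: heaviside_def split: if_splits)
    show ?thesis
    proof (rule integrable_frac_kernel_mult[where M = "M * N" and R = R])
      show "\<bar>heaviside s * w s * \<kappa> (s + r)\<bar> \<le> M * N" if "r > 0" for s r
      proof (cases "heaviside s * w s * \<kappa> (s + r) = 0")
        case True show ?thesis unfolding True using M(1) N0 by simp
      next
        case False
        with supp[OF _ that] that have "s \<le> R" by force
        then show ?thesis
          unfolding abs_mult[of _ "\<kappa> (s + r)"] using M N0 \<kappa>(2) by (intro mult_mono) auto
      qed
      show "norm s \<le> R \<and> r \<le> R" if "r > 0" "heaviside s * w s * \<kappa> (s + r) \<noteq> 0" for s r
        using supp[OF that(2,1)] that(1) by auto
    qed (use \<alpha> in simp_all)
  qed

  \<comment> \<open>Fixed lag: the boundary term at \<open>s = 0\<close> is the contribution of the initial value.\<close>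
  let ?I = "\<lambda>r. \<integral>s. heaviside s * p s * \<theta> (s + r) \<partial>lborel"
  have by_parts: "(\<integral>s. heaviside s * v s * \<theta>' (s + r) \<partial>lborel) = - (v 0 * \<theta> r) - ?I r" if "r \<ge> 0" for r
  proof -
    have z: "\<theta> (s + r) = 0" "\<theta>' (s + r) = 0" if "s \<ge> max R 0" for s
      using R[of "s + r"] that \<open>r \<ge> 0\<close> by auto
    have \<theta>r: "continuous_on {0..} (\<lambda>s. \<theta> (s + r))" "continuous_on {0..} (\<lambda>s. \<theta>' (s + r))"
      by (intro continuous_on_compose2[OF \<theta>_cont] continuous_on_compose2[OF \<theta>'] continuous_intros; simp)+
    have int: "integrable lborel (\<lambda>s. heaviside s * (v s * \<theta>' (s + r)))"
      "integrable lborel (\<lambda>s. heaviside s * (p s * \<theta> (s + r)))"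
      using z by (intro half_line_integrable[where R = "max R 0"] continuous_on_mult v_cont p \<theta>r; simp)+
    have "(\<integral>s. heaviside s * (p s * \<theta> (s + r) + v s * \<theta>' (s + r)) \<partial>lborel) = - (v 0 * \<theta> (0 + r))"
    proof (rule half_line_FTC[where R = "max R 0"])
      show "((\<lambda>s. v s * \<theta> (s + r)) has_real_derivative p t * \<theta> (t + r) + v t * \<theta>' (t + r)) (at t within {0..})"
        if "t \<ge> 0" for t
      proof -
        have "((\<lambda>s. \<theta> (s + r)) has_real_derivative \<theta>' (t + r)) (at t within {0..})"
          using DERIV_shift[of \<theta> "\<theta>' (t + r)" t r] \<theta>[of "t + r"]
          by (auto intro: has_field_derivative_at_within)
        from DERIV_mult[OF v[OF that] this] show ?thesis by (simp add: algebra_simps)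
      qed
      show "continuous_on {0..} (\<lambda>s. p s * \<theta> (s + r) + v s * \<theta>' (s + r))"
        by (intro continuous_on_add continuous_on_mult v_cont p \<theta>r)
    qed (use z in simp_all)
    moreover have "(\<integral>s. heaviside s * (p s * \<theta> (s + r) + v s * \<theta>' (s + r)) \<partial>lborel)
        = (\<integral>s. heaviside s * (v s * \<theta>' (s + r)) \<partial>lborel) + (\<integral>s. heaviside s * (p s * \<theta> (s + r)) \<partial>lborel)"
      using int by (simp add: distrib_left)
    ultimately show ?thesis by (simp add: mult.assoc)
  qed

  let ?G = "\<lambda>s r. frac_kernel \<alpha> r * (heaviside s * p s * \<theta> (s + r))"
  have G: "integrable (lborel \<Otimes>\<^sub>M lborel) (case_prod ?G)"
    by (rule joint[OF p _ R(1) N(1)]) simp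
  have kI: "integrable lborel (\<lambda>r. frac_kernel \<alpha> r * ?I r)"
    using lborel_pair.integrable_snd[OF G] by simp
  have k\<theta>: "integrable lborel (\<lambda>r. frac_kernel \<alpha> r * \<theta> r)"
  proof (rule Bochner_Integration.integrable_bound)
    show "integrable lborel (\<lambda>r. (indicator {0..max R 0} r * frac_kernel \<alpha> r) * N)"
      using frac_kernel_integral[OF \<alpha>, of "max R 0"] by (auto simp: has_bochner_integral_iff)
    show "AE r in lborel. norm (frac_kernel \<alpha> r * \<theta> r)
        \<le> norm ((indicator {0..max R 0} r * frac_kernel \<alpha> r) * N)"
    proof (intro always_eventually allI)
      fix r
      show "norm (frac_kernel \<alpha> r * \<theta> r) \<le> norm ((indicator {0..max R 0} r * frac_kernel \<alpha> r) * N)"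
        using R(1)[of r] N(1)[of r] N0 frac_kernel_nonneg[of \<alpha> r] frac_kernel_eq_0[of r \<alpha>]
        by (cases "r \<le> 0"; cases "r \<ge> R") (auto simp: abs_mult indicator_def intro: mult_left_mono)
    qed
  qed simp

  have "(\<integral>s. heaviside s * v s * (\<integral>r. frac_kernel \<alpha> r * \<theta>' (s + r) \<partial>lborel) \<partial>lborel)
      = (\<integral>s. (\<integral>r. frac_kernel \<alpha> r * (heaviside s * v s * \<theta>' (s + r)) \<partial>lborel) \<partial>lborel)"
    by (subst integral_mult_right_zero[symmetric]) (simp add: mult_ac)
  also have "\<dots> = (\<integral>r. (\<integral>s. frac_kernel \<alpha> r * (heaviside s * v s * \<theta>' (s + r)) \<partial>lborel) \<partial>lborel)"
    by (rule lborel_pair.Fubini_integral[symmetric], rule joint[OF v_cont _ R(2) N(2)]) simp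
  also have "\<dots> = (\<integral>r. - (v 0 * (frac_kernel \<alpha> r * \<theta> r)) - frac_kernel \<alpha> r * ?I r \<partial>lborel)"
  proof (rule Bochner_Integration.integral_cong[OF refl])
    fix r
    show "(\<integral>s. frac_kernel \<alpha> r * (heaviside s * v s * \<theta>' (s + r)) \<partial>lborel)
        = - (v 0 * (frac_kernel \<alpha> r * \<theta> r)) - frac_kernel \<alpha> r * ?I r"
    proof (cases "r \<ge> 0")
      case True
      have "(\<integral>s. frac_kernel \<alpha> r * (heaviside s * v s * \<theta>' (s + r)) \<partial>lborel)
          = frac_kernel \<alpha> r * (- (v 0 * \<theta> r) - ?I r)"
        by (simp add: by_parts[OF True])
      then show ?thesis by (simp add: algebra_simps)
    qed (simp add: frac_kernel_eq_0)
  qed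
  also have "\<dots> = - (v 0 * (\<integral>r. frac_kernel \<alpha> r * \<theta> r \<partial>lborel)) - (\<integral>r. frac_kernel \<alpha> r * ?I r \<partial>lborel)"
    using kI k\<theta> by simp
  also have "(\<integral>r. frac_kernel \<alpha> r * ?I r \<partial>lborel) = (\<integral>r. (\<integral>s. ?G s r \<partial>lborel) \<partial>lborel)"
    by simp
  also have "\<dots> = (\<integral>s. (\<integral>r. ?G s r \<partial>lborel) \<partial>lborel)"
    by (rule lborel_pair.Fubini_integral[OF G])
  also have "\<dots> = (\<integral>t. (\<integral>s. ?G s (t - s) \<partial>lborel) \<partial>lborel)"
    by (rule lborel_shear[OF G]) simp
  also have "\<dots> = (\<integral>t. heaviside t * \<theta> t * (LINT s:{0<..<t}|lborel. p s / (t - s) powr \<alpha>) \<partial>lborel)"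
  proof (rule Bochner_Integration.integral_cong[OF refl])
    fix t
    let ?c = "\<lambda>s. indicator {0<..<t} s *\<^sub>R (p s / (t - s) powr \<alpha>)"
    \<comment> \<open>The point \<open>s = 0\<close> is lost, because the defining integral of the Caputo derivative runs over
      an open interval; \<open>s = t\<close> does no harm, as \<open>0 powr (- \<alpha>) = 0\<close>.\<close>
    have eq: "frac_kernel \<alpha> (t - s) * (heaviside s * p s) = heaviside t * ?c s" if "s \<noteq> 0" for s
      using that by (auto simp: frac_kernel_def heaviside_def indicator_def powr_minus divide_inverse)
    have meas: "(\<lambda>s. frac_kernel \<alpha> (t - s) * (heaviside s * p s)) \<in> borel_measurable lborel"
      by simp
    have "(\<integral>s. ?G s (t - s) \<partial>lborel) = \<theta> t * (\<integral>s. frac_kernel \<alpha> (t - s) * (heaviside s * p s) \<partial>lborel)"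
      by (subst integral_mult_right_zero[symmetric]) (simp add: mult_ac)
    also have "(\<integral>s. frac_kernel \<alpha> (t - s) * (heaviside s * p s) \<partial>lborel) = (\<integral>s. heaviside t * ?c s \<partial>lborel)"
    proof (rule integral_cong_AE[OF meas])
      have "(\<lambda>s. if s = 0 then 0 else frac_kernel \<alpha> (t - s) * (heaviside s * p s)) \<in> borel_measurable lborel"
        using meas by measurable
      also have "(\<lambda>s. if s = 0 then 0 else frac_kernel \<alpha> (t - s) * (heaviside s * p s))
          = (\<lambda>s. heaviside t * ?c s)"
        using eq by (auto simp: fun_eq_iff)
      finally show "(\<lambda>s. heaviside t * ?c s) \<in> borel_measurable lborel" .
      show "AE s in lborel. frac_kernel \<alpha> (t - s) * (heaviside s * p s) = heaviside t * ?c s"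
        using AE_lborel_singleton[of 0] by eventually_elim (rule eq)
    qed
    also have "\<dots> = heaviside t * (LINT s:{0<..<t}|lborel. p s / (t - s) powr \<alpha>)"
      unfolding set_lebesgue_integral_def by (rule integral_mult_right_zero)
    finally show "(\<integral>s. ?G s (t - s) \<partial>lborel)
        = heaviside t * \<theta> t * (LINT s:{0<..<t}|lborel. p s / (t - s) powr \<alpha>)"
      by (simp add: mult_ac)
  qed
  finally show ?thesis .
qed

text \<open>The integral behaves like \<open>p 0 * t powr (1 - \<alpha>) / (1 - \<alpha>)\<close> as \<open>t\<close> tends to 0. Since
  \<open>0 < 1 - \<alpha> < 1\<close>, this tends to 0 but has infinite slope unless \<open>p 0 = 0\<close>. So if a multiple of it
  agrees for \<open>t > 0\<close> with a function that is differentiable up to \<open>t = 0\<close>, the leading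
  coefficient vanishes.\<close>

lemma caputo_regular_imp_zero_velocity:
  fixes p G :: "real \<Rightarrow> real"
  assumes \<alpha>: "0 < \<alpha>" "\<alpha> < 1"
    and p: "continuous_on {0..} p"
    and G: "(G has_real_derivative G') (at 0 within {0..})"
    and eq: "\<And>t. t > 0 \<Longrightarrow> G t = A * (LINT s:{0<..<t}|lborel. p s / (t - s) powr \<alpha>)"
  shows "A * p 0 = 0" and "G 0 = 0"
proof -
  let ?C = "\<lambda>t. LINT s:{0<..<t}|lborel. p s / (t - s) powr \<alpha>"
  let ?k = "\<lambda>t s. indicator {0<..<t} s * frac_kernel \<alpha> (t - s)"
  note [measurable] = half_line_measurable[OF p]
  have k: "integrable lborel (?k t)" "(\<integral>s. ?k t s \<partial>lborel) = t powr (1 - \<alpha>) / (1 - \<alpha>)" if "t > 0" for t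
  proof -
    let ?g = "\<lambda>r. indicator {0..t} r * frac_kernel \<alpha> r"
    have g: "integrable lborel ?g" "integral\<^sup>L lborel ?g = t powr (1 - \<alpha>) / (1 - \<alpha>)"
      using frac_kernel_integral[OF \<alpha>(2), of t] that by (auto simp: has_bochner_integral_iff)
    have "integrable lborel (\<lambda>s. ?g (t - s))" "(\<integral>s. ?g (t - s) \<partial>lborel) = integral\<^sup>L lborel ?g"
      using lborel_integrable_real_affine[OF g(1), of "-1" t]
        lborel_integral_real_affine[of "-1" ?g t] by auto
    moreover have "AE s in lborel. ?g (t - s) = ?k t s"
      using AE_lborel_singleton[of 0] AE_lborel_singleton[of t]
      by eventually_elim (auto simp: indicator_def)
    ultimately show "integrable lborel (?k t)" "(\<integral>s. ?k t s \<partial>lborel) = t powr (1 - \<alpha>) / (1 - \<alpha>)"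
      using integrable_cong_AE[of ?g] integral_cong_AE[of "\<lambda>s. ?g (t - s)" lborel "?k t"] g(2)
      by (auto simp: integrable_cong_AE[of "\<lambda>s. ?g (t - s)" lborel "?k t"])
  qed
  have C_eq: "?C t = (\<integral>s. heaviside s * p s * ?k t s \<partial>lborel)" for t
    unfolding set_lebesgue_integral_def
    by (intro Bochner_Integration.integral_cong)
      (auto simp: indicator_def frac_kernel_def heaviside_def powr_minus divide_inverse)
  \<comment> \<open>Near the origin \<open>p\<close> may be replaced by \<open>p 0\<close>.\<close>
  have lim: "((\<lambda>t. ?C t / t powr (1 - \<alpha>)) \<longlongrightarrow> p 0 / (1 - \<alpha>)) (at_right 0)"
  proof (rule tendstoI)
    fix e :: real assume "e > 0"
    define \<epsilon> where "\<epsilon> = e * (1 - \<alpha>) / 2"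
    have \<epsilon>: "\<epsilon> > 0" using \<open>e > 0\<close> \<alpha> by (simp add: \<epsilon>_def)
    have "(p \<longlongrightarrow> p 0) (at 0 within {0..})" using p by (auto simp: continuous_on)
    then have "eventually (\<lambda>s. dist (p s) (p 0) < \<epsilon>) (at_right 0)"
      using \<epsilon> by (metis at_within_Ici_at_right tendstoD)
    then obtain \<delta> where \<delta>: "\<delta> > 0" "\<And>s. 0 < s \<Longrightarrow> s < \<delta> \<Longrightarrow> \<bar>p s - p 0\<bar> \<le> \<epsilon>"
      by (auto simp: eventually_at_right_field dist_real_def less_imp_le)
    have "dist (?C t / t powr (1 - \<alpha>)) (p 0 / (1 - \<alpha>)) < e" if t: "0 < t" "t < \<delta>" for t
    proof -
      have bd: "\<bar>(heaviside s * p s - p 0) * ?k t s\<bar> \<le> \<epsilon> * ?k t s" for s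
        using \<delta>(2)[of s] t frac_kernel_nonneg[of \<alpha> "t - s"]
        by (auto simp: indicator_def heaviside_def abs_mult intro: mult_right_mono)
      have "integrable lborel (\<lambda>s. (heaviside s * p s - p 0) * ?k t s)"
        by (rule Bochner_Integration.integrable_bound[OF integrable_mult_right[OF k(1)[OF t(1)], of \<epsilon>]])
          (use bd in \<open>auto intro!: always_eventually intro: order_trans[OF _ abs_ge_self]\<close>)
      note int = this
      have "?C t - p 0 * (\<integral>s. ?k t s \<partial>lborel) = (\<integral>s. (heaviside s * p s - p 0) * ?k t s \<partial>lborel)"
      proof -
        have "(\<integral>s. (heaviside s * p s - p 0) * ?k t s + p 0 * ?k t s \<partial>lborel)
            = (\<integral>s. (heaviside s * p s - p 0) * ?k t s \<partial>lborel) + (\<integral>s. p 0 * ?k t s \<partial>lborel)"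
          using int k(1)[OF t(1)] by (intro Bochner_Integration.integral_add) auto
        then show ?thesis unfolding C_eq by (simp add: algebra_simps)
      qed
      also have "\<bar>\<dots>\<bar> \<le> (\<integral>s. \<epsilon> * ?k t s \<partial>lborel)"
        by (rule order_trans[OF integral_abs_bound
              integral_mono[OF integrable_abs[OF int] integrable_mult_right[OF k(1)[OF t(1)], of \<epsilon>] bd]])
      finally have "\<bar>?C t - p 0 * (t powr (1 - \<alpha>) / (1 - \<alpha>))\<bar> \<le> \<epsilon> * (t powr (1 - \<alpha>) / (1 - \<alpha>))"
        using k(2)[OF t(1)] by simp
      moreover have "?C t / t powr (1 - \<alpha>) - p 0 / (1 - \<alpha>)
          = (?C t - p 0 * (t powr (1 - \<alpha>) / (1 - \<alpha>))) / t powr (1 - \<alpha>)"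
        using t by (simp add: diff_divide_distrib)
      ultimately have "\<bar>?C t / t powr (1 - \<alpha>) - p 0 / (1 - \<alpha>)\<bar> \<le> \<epsilon> / (1 - \<alpha>)"
        using t by (simp add: abs_divide divide_le_eq)
      also have "\<epsilon> / (1 - \<alpha>) = e / 2" using \<alpha>(2) by (simp add: \<epsilon>_def divide_simps)
      also have "e / 2 < e" using \<open>e > 0\<close> by simp
      finally show ?thesis by (simp add: dist_real_def)
    qed
    then show "eventually (\<lambda>t. dist (?C t / t powr (1 - \<alpha>)) (p 0 / (1 - \<alpha>)) < e) (at_right 0)"
      using \<delta>(1) by (auto simp: eventually_at_right_field)
  qed
  have pos: "eventually (\<lambda>t::real. t > 0) (at_right 0)" by (rule eventually_at_right_less)
  have pow0: "((\<lambda>t. t powr \<beta>) \<longlongrightarrow> 0) (at_right 0)" if "\<beta> > 0" for \<beta> :: real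
  proof -
    have "((\<lambda>t. t powr \<beta>) \<longlongrightarrow> 0 powr \<beta>) (at_right 0)"
      by (rule tendsto_powr'[OF tendsto_ident_at tendsto_const])
        (use that in \<open>auto intro: eventually_mono[OF pos]\<close>)
    then show ?thesis using that by simp
  qed
  have lim_G: "((\<lambda>t. G t / t powr (1 - \<alpha>)) \<longlongrightarrow> A * (p 0 / (1 - \<alpha>))) (at_right 0)"
    using tendsto_mult_left[OF lim, of A]
    by (rule Lim_transform_eventually) (use pos in \<open>eventually_elim, simp add: eq\<close>)
  have "((\<lambda>t. G t / t powr (1 - \<alpha>) * t powr (1 - \<alpha>)) \<longlongrightarrow> A * (p 0 / (1 - \<alpha>)) * 0) (at_right 0)"
    using \<alpha> by (intro tendsto_mult lim_G pow0) auto
  then have "(G \<longlongrightarrow> 0) (at_right 0)"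
    by (simp, elim Lim_transform_eventually) (use pos in \<open>eventually_elim, simp\<close>)
  moreover have "(G \<longlongrightarrow> G 0) (at_right 0)"
    using DERIV_continuous[OF G] by (simp add: continuous_within at_within_Ici_at_right)
  ultimately show G0: "G 0 = 0"
    by (rule tendsto_unique[OF trivial_limit_at_right_real, symmetric])
  \<comment> \<open>A function that vanishes and is differentiable at the origin is \<open>O(t)\<close>, hence
    \<open>o(t powr (1 - \<alpha>))\<close>; this determines the limit in \<open>lim_G\<close>.\<close>
  have "((\<lambda>t. G t / t) \<longlongrightarrow> G') (at_right 0)"
    using G by (simp add: has_field_derivative_iff at_within_Ici_at_right G0)
  then have "((\<lambda>t. G t / t * t powr \<alpha>) \<longlongrightarrow> G' * 0) (at_right 0)"
    using \<alpha> by (intro tendsto_mult pow0)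
  then have "((\<lambda>t. G t / t powr (1 - \<alpha>)) \<longlongrightarrow> G' * 0) (at_right 0)"
    by (rule Lim_transform_eventually)
      (use pos in \<open>eventually_elim, simp add: powr_diff\<close>)
  from tendsto_unique[OF trivial_limit_at_right_real lim_G this] show "A * p 0 = 0"
    using \<alpha> by simp
qed

section \<open>Convolution in time with \<open>\<Phi>\<^sub>-\<^sub>\<alpha>\<close>\<close>

text \<open>The limit \<open>- 1 / \<Gamma>(1 - \<alpha>) * \<integral> J\<close> is the double integral that results from the test function
  \<open>(s, r) \<mapsto> \<psi>(x, s + r)\<close> without any cutoff. In the region \<open>s \<ge> 0\<close>, \<open>r > 0\<close>, where the factors
  of the convolution live, \<open>\<psi>(x, s + r)\<close> vanishes unless \<open>r < R\<close>. By compactness of \<open>[0, R]\<close> only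
  finitely many members of the partition are nonzero there, and they sum to 1. So all but finitely
  many summands vanish, and the rest add up to the claimed value.\<close>

lemma time_conv_Phi_neg:
  fixes k \<psi> :: "'a::euclidean_space \<times> real \<Rightarrow> real"
  assumes \<alpha>: "\<alpha> < 1"
    and k: "continuous_on (UNIV \<times> {0..}) k" and \<psi>: "test_function \<psi>"
  defines "J \<equiv> \<lambda>(z, r). frac_kernel \<alpha> r *
      (heaviside (snd z) * k z * dir_deriv (0, 1) \<psi> (fst z, snd z + r))"
  shows "integrable (lborel \<Otimes>\<^sub>M lborel) J"
    and "time_conv (dist_of (\<lambda>z. heaviside (snd z) * k z)) (Phi_neg \<alpha>) \<psi>
      = - (1 / Gamma (1 - \<alpha>)) * integral\<^sup>L (lborel \<Otimes>\<^sub>M lborel) J"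
proof -
  let ?\<psi>' = "dir_deriv (0, 1) \<psi>"
  have \<psi>': "test_function ?\<psi>'" using \<psi> by (rule test_function_dir_deriv)
  obtain R where R: "R > 0" "\<And>z. norm z \<ge> R \<Longrightarrow> \<psi> z = 0" using test_function_support[OF \<psi>] by blast
  obtain R' where R': "\<And>z. norm z \<ge> R' \<Longrightarrow> ?\<psi>' z = 0" using test_function_support[OF \<psi>'] by blast
  obtain N where N: "N > 0" "\<And>z. \<bar>\<psi> z\<bar> \<le> N" using test_function_bounded[OF \<psi>] by blast
  obtain N' where N': "N' > 0" "\<And>z. \<bar>?\<psi>' z\<bar> \<le> N'" using test_function_bounded[OF \<psi>'] by blast
  note [measurable] = borel_measurable_heaviside_mult[OF k, folded borel_prod]
    borel_measurable_continuous_onI[OF test_function_continuous[OF \<psi>], folded borel_prod]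
    borel_measurable_continuous_onI[OF test_function_continuous[OF \<psi>'], folded borel_prod]

  \<comment> \<open>On \<open>snd z \<ge> 0\<close>, \<open>r > 0\<close> a bound on \<open>snd z + r\<close> bounds both summands; this is where the
    supports bounded from below are used.\<close>
  have joint: "integrable (lborel \<Otimes>\<^sub>M lborel) (\<lambda>(z, r). frac_kernel \<alpha> r * (heaviside (snd z) * k z * \<kappa> z r))"
    if meas: "case_prod \<kappa> \<in> borel_measurable ((borel \<Otimes>\<^sub>M borel) \<Otimes>\<^sub>M borel)"
      and B: "\<And>z r. \<bar>\<kappa> z r\<bar> \<le> B"
      and S: "\<And>z r. norm (fst z, snd z + r) \<ge> S \<Longrightarrow> \<kappa> z r = 0"
    for \<kappa> :: "'a \<times> real \<Rightarrow> real \<Rightarrow> real" and B S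
  proof -
    have B0: "0 \<le> B" using order_trans[OF abs_ge_zero B] .
    obtain M where M: "M > 0" "\<And>z. norm z \<le> 2 * S \<Longrightarrow> \<bar>heaviside (snd z) * k z\<bar> \<le> M"
      using half_space_bound[OF k] by blast
    have supp: "norm z \<le> 2 * S \<and> r \<le> 2 * S"
      if "heaviside (snd z) * k z * \<kappa> z r \<noteq> 0" "r > 0" for z r
    proof -
      have "snd z \<ge> 0" using that(1) by (auto simp: heaviside_def split: if_splits)
      moreover have "norm (fst z, snd z + r) < S" using S[of z r] that(1) by force
      moreover have "norm (fst z) \<le> norm (fst z, snd z + r)" by (rule norm_fst_le)
      moreover have "\<bar>snd z + r\<bar> \<le> norm (fst z, snd z + r)"
        using norm_snd_le[where x = "fst z" and y = "snd z + r"] by simp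
      moreover have "norm z \<le> norm (fst z) + \<bar>snd z\<bar>"
        using norm_Pair_le[of "fst z" "snd z"] by simp
      ultimately show ?thesis using that(2) by linarith
    qed
    show ?thesis
    proof (rule integrable_frac_kernel_mult[where M = "M * B" and R = "2 * S"])
      show "(\<lambda>(z, r). heaviside (snd z) * k z * \<kappa> z r) \<in> borel_measurable (borel \<Otimes>\<^sub>M borel)"
        using meas unfolding borel_prod[symmetric, where ?'a = 'a and ?'b = real] by measurable
      show "\<bar>heaviside (snd z) * k z * \<kappa> z r\<bar> \<le> M * B" if "r > 0" for z r
      proof (cases "heaviside (snd z) * k z * \<kappa> z r = 0")
        case True show ?thesis unfolding True using M(1) B0 by simp
      next
        case False
        with supp[OF _ that] have "norm z \<le> 2 * S" by blast
        then show ?thesis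
          unfolding abs_mult[of _ "\<kappa> z r"] using M B0 B by (intro mult_mono) auto
      qed
      show "norm z \<le> 2 * S \<and> r \<le> 2 * S" if "r > 0" "heaviside (snd z) * k z * \<kappa> z r \<noteq> 0" for z r
        using supp[OF that(2,1)] .
    qed (use \<alpha> in simp_all)
  qed

  show "integrable (lborel \<Otimes>\<^sub>M lborel) J"
    unfolding J_def by (rule joint[OF _ N'(2) R']) measurable

  let ?T = "dist_of (\<lambda>z. heaviside (snd z) * k z)"
  let ?Y = "- (1 / Gamma (1 - \<alpha>)) * integral\<^sup>L (lborel \<Otimes>\<^sub>M lborel) J"
  let ?term = "\<lambda>h j. ?T (\<lambda>(x, s). dist_mult (h j) (Phi_neg \<alpha>) (\<lambda>r. \<psi> (x, s + r)))"
  have sums: "?term h sums ?Y" if h: "smooth_partition_of_unity h" for h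
  proof -
    have th: "test_function (h j)" for j using h by (simp add: smooth_partition_of_unity_def)
    define D where "D j z r = h j r * ?\<psi>' (fst z, snd z + r) + dir_deriv 1 (h j) r * \<psi> (fst z, snd z + r)"
      for j and z :: "'a \<times> real" and r
    have D: "((\<lambda>r. h j r * \<psi> (x, s + r)) has_real_derivative D j (x, s) r) (at r)" for j x s r
    proof -
      have "((\<lambda>r. \<psi> (x, s + r)) has_real_derivative ?\<psi>' (x, s + r)) (at r)"
        using test_function_time_deriv[OF \<psi>, of x "r + s"]
          DERIV_shift[of "\<lambda>t. \<psi> (x, t)" "?\<psi>' (x, r + s)" r s] by (simp add: add.commute)
      from DERIV_mult'[OF test_function_real_deriv[OF th] this] show ?thesis
        by (simp add: D_def)
    qed
    have D_int: "integrable (lborel \<Otimes>\<^sub>M lborel) (\<lambda>(z, r). frac_kernel \<alpha> r * (heaviside (snd z) * k z * D j z r))" for j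
    proof -
      have th': "test_function (dir_deriv 1 (h j))" using th by (rule test_function_dir_deriv)
      obtain B where B: "B > 0" "\<And>r. \<bar>h j r\<bar> \<le> B" using test_function_bounded[OF th] by blast
      obtain B' where B': "B' > 0" "\<And>r. \<bar>dir_deriv 1 (h j) r\<bar> \<le> B'" using test_function_bounded[OF th'] by blast
      note [measurable] = borel_measurable_continuous_onI[OF test_function_continuous[OF th]]
        borel_measurable_continuous_onI[OF test_function_continuous[OF th']]
      show ?thesis
      proof (rule joint[where B = "B * N' + B' * N" and S = "max R R'"])
        show "case_prod (D j) \<in> borel_measurable ((borel \<Otimes>\<^sub>M borel) \<Otimes>\<^sub>M borel)"
          unfolding D_def by measurable
        show "\<bar>D j z r\<bar> \<le> B * N' + B' * N" for z r
          unfolding D_def using B B' N N'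
          by (intro order_trans[OF abs_triangle_ineq] add_mono; simp add: abs_mult mult_mono)
        show "D j z r = 0" if "norm (fst z, snd z + r) \<ge> max R R'" for z r
          using that R(2) R' by (simp add: D_def)
      qed
    qed
    have term_eq: "?term h j = - (1 / Gamma (1 - \<alpha>))
        * (\<integral>q. (case q of (z, r) \<Rightarrow> frac_kernel \<alpha> r * (heaviside (snd z) * k z * D j z r)) \<partial>(lborel \<Otimes>\<^sub>M lborel))" for j
    proof -
      have "?term h j = (\<integral>z. heaviside (snd z) * k z *
          (- (1 / Gamma (1 - \<alpha>)) * (\<integral>r. frac_kernel \<alpha> r * D j z r \<partial>lborel)) \<partial>lborel)"
        by (simp add: dist_of_def dist_mult_def Phi_neg_def dist_deriv_def frac_kernel_def
            dir_deriv_1_eq[OF D] case_prod_unfold)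
      also have "\<dots> = - (1 / Gamma (1 - \<alpha>)) *
          (\<integral>z. (\<integral>r. frac_kernel \<alpha> r * (heaviside (snd z) * k z * D j z r) \<partial>lborel) \<partial>lborel)"
      proof -
        have "(\<integral>r. frac_kernel \<alpha> r * (heaviside (snd z) * k z * D j z r) \<partial>lborel)
            = heaviside (snd z) * k z * (\<integral>r. frac_kernel \<alpha> r * D j z r \<partial>lborel)" for z
          by (subst integral_mult_right_zero[symmetric]) (simp add: mult_ac)
        note inner = this
        show ?thesis unfolding inner by (subst integral_mult_right_zero[symmetric]) (simp add: mult_ac)
      qed
      also have "(\<integral>z. (\<integral>r. frac_kernel \<alpha> r * (heaviside (snd z) * k z * D j z r) \<partial>lborel) \<partial>lborel)
          = (\<integral>q. (case q of (z, r) \<Rightarrow> frac_kernel \<alpha> r * (heaviside (snd z) * k z * D j z r)) \<partial>(lborel \<Otimes>\<^sub>M lborel))"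
        using lborel_pair.integral_fst'[OF D_int] by simp
      finally show ?thesis .
    qed

    define I where "I = {j. \<exists>r\<in>{0..R}. h j r \<noteq> 0}"
    have I: "finite I"
    proof -
      have "\<forall>t. \<exists>V. open V \<and> t \<in> V \<and> finite {j. \<exists>s\<in>V. h j s \<noteq> 0}"
        using h by (simp add: smooth_partition_of_unity_def)
      from choice[OF this] obtain V where
        V: "\<forall>t. open (V t) \<and> t \<in> V t \<and> finite {j. \<exists>s\<in>V t. h j s \<noteq> 0}" ..
      have "compact {0..R}" "\<And>t. t \<in> {0..R} \<Longrightarrow> open (V t)" "{0..R} \<subseteq> (\<Union>t\<in>{0..R}. V t)"
        using V by auto
      then obtain C where C: "C \<subseteq> {0..R}" "finite C" "{0..R} \<subseteq> (\<Union>t\<in>C. V t)"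
        by (rule compactE_image)
      have "I \<subseteq> (\<Union>t\<in>C. {j. \<exists>s\<in>V t. h j s \<noteq> 0})"
      proof
        fix j assume "j \<in> I"
        then obtain r where r: "r \<in> {0..R}" "h j r \<noteq> 0" unfolding I_def by blast
        with C(3) obtain t where "t \<in> C" "r \<in> V t" by blast
        with r(2) show "j \<in> (\<Union>t\<in>C. {j. \<exists>s\<in>V t. h j s \<noteq> 0})" by blast
      qed
      then show ?thesis using C(2) V by (elim finite_subset) simp
    qed
    have sum_h: "(\<Sum>j\<in>I. h j r) = 1" if "0 \<le> r" "r \<le> R" for r
    proof -
      have "(\<Sum>j | h j r \<noteq> 0. h j r) = (\<Sum>j\<in>I. h j r)"
        using that I by (intro sum.mono_neutral_left) (auto simp: I_def)
      then show ?thesis using h by (simp add: smooth_partition_of_unity_def)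
    qed
    have psi0: "\<psi> (x, s + r) = 0" if "s \<ge> 0" "r \<ge> R" for x s r
      using that R norm_snd_le[where x = x and y = "s + r"] by (intro R(2)) auto
    have D_out: "D j (x, s) r = 0" if "j \<notin> I" "s \<ge> 0" "r > 0" for j x s r
    proof -
      have "((\<lambda>r. h j r * \<psi> (x, s + r)) has_real_derivative 0) (at r)"
      proof (rule has_field_derivative_transform_within_open[where f = "\<lambda>_. 0" and S = "{0<..}"])
        show "0 = h j r * \<psi> (x, s + r)" if "r \<in> {0<..}" for r
          using that \<open>j \<notin> I\<close> psi0[OF \<open>s \<ge> 0\<close>, of r x] by (cases "r \<le> R") (auto simp: I_def)
      qed (use that in auto)
      with D show ?thesis by (rule DERIV_unique)
    qed
    \<comment> \<open>The identity \<open>\<Sum> h\<^sub>j = 1\<close> holds on \<open>[0, R]\<close> only, but \<open>\<psi>(x, s + r)\<close> vanishes for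
      \<open>r \<ge> R\<close>. So the sum of the products equals \<open>\<psi>(x, s + r)\<close> on the whole open half-line and may
      be differentiated there.\<close>
    have D_sum: "(\<Sum>j\<in>I. D j (x, s) r) = ?\<psi>' (x, s + r)" if "s \<ge> 0" "r > 0" for x s r
    proof -
      have "((\<lambda>r. \<Sum>j\<in>I. h j r * \<psi> (x, s + r)) has_real_derivative (\<Sum>j\<in>I. D j (x, s) r)) (at r)"
        by (intro DERIV_sum D)
      moreover have "((\<lambda>r. \<Sum>j\<in>I. h j r * \<psi> (x, s + r)) has_real_derivative ?\<psi>' (x, s + r)) (at r)"
      proof (rule has_field_derivative_transform_within_open[where S = "{0<..}"])
        show "((\<lambda>r. \<psi> (x, s + r)) has_real_derivative ?\<psi>' (x, s + r)) (at r)"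
          using test_function_time_deriv[OF \<psi>, of x "r + s"]
            DERIV_shift[of "\<lambda>t. \<psi> (x, t)" "?\<psi>' (x, r + s)" r s] by (simp add: add.commute)
        show "\<psi> (x, s + r) = (\<Sum>j\<in>I. h j r * \<psi> (x, s + r))" if "r \<in> {0<..}" for r
          using that sum_h[of r] psi0[OF \<open>s \<ge> 0\<close>, of r x]
          by (cases "r \<le> R") (auto simp: sum_distrib_right[symmetric])
      qed (use that in auto)
      ultimately show ?thesis by (rule DERIV_unique)
    qed

    have "?term h j = 0" if "j \<notin> I" for j
    proof -
      have "frac_kernel \<alpha> r * (heaviside (snd z) * k z * D j z r) = 0" for z r
      proof (cases "0 < r \<and> 0 \<le> snd z")
        case True then show ?thesis using D_out[OF that, of "snd z" r "fst z"] by simp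
      next
        case False then show ?thesis by (auto simp: frac_kernel_eq_0 heaviside_def)
      qed
      then have "(\<lambda>(z, r). frac_kernel \<alpha> r * (heaviside (snd z) * k z * D j z r)) = (\<lambda>_. 0)"
        unfolding fun_eq_iff by auto
      then show ?thesis unfolding term_eq by (simp only: integral_zero mult_zero_right)
    qed
    then have "?term h sums (\<Sum>j\<in>I. ?term h j)" using I by (intro sums_finite)
    also have "(\<Sum>j\<in>I. ?term h j) = - (1 / Gamma (1 - \<alpha>)) * (\<Sum>j\<in>I. (\<integral>q. (case q of (z, r) \<Rightarrow>
        frac_kernel \<alpha> r * (heaviside (snd z) * k z * D j z r)) \<partial>(lborel \<Otimes>\<^sub>M lborel)))"
      unfolding term_eq by (rule sum_distrib_left[symmetric])
    also have "(\<Sum>j\<in>I. (\<integral>q. (case q of (z, r) \<Rightarrow>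
        frac_kernel \<alpha> r * (heaviside (snd z) * k z * D j z r)) \<partial>(lborel \<Otimes>\<^sub>M lborel)))
      = (\<integral>q. (\<Sum>j\<in>I. (case q of (z, r) \<Rightarrow> frac_kernel \<alpha> r * (heaviside (snd z) * k z * D j z r)))
          \<partial>(lborel \<Otimes>\<^sub>M lborel))"
      by (rule Bochner_Integration.integral_sum[symmetric]) (rule D_int)
    also have "\<dots> = integral\<^sup>L (lborel \<Otimes>\<^sub>M lborel) J"
    proof (rule Bochner_Integration.integral_cong[OF refl])
      fix q :: "('a \<times> real) \<times> real"
      obtain x s r where q: "q = ((x, s), r)" by (metis surj_pair)
      have "(\<Sum>j\<in>I. (case q of (z, r) \<Rightarrow> frac_kernel \<alpha> r * (heaviside (snd z) * k z * D j z r)))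
          = frac_kernel \<alpha> r * (heaviside s * k (x, s)) * (\<Sum>j\<in>I. D j (x, s) r)"
        by (simp only: q case_prod_conv snd_conv sum_distrib_left mult.assoc)
      also have "\<dots> = frac_kernel \<alpha> r * (heaviside s * k (x, s)) * ?\<psi>' (x, s + r)"
      proof (cases "0 < r \<and> 0 \<le> s")
        case True then show ?thesis by (simp only: D_sum)
      next
        case False then show ?thesis by (auto simp: frac_kernel_eq_0 heaviside_def)
      qed
      also have "\<dots> = J q" by (simp only: q J_def case_prod_conv fst_conv snd_conv mult.assoc)
      finally show "(\<Sum>j\<in>I. (case q of (z, r) \<Rightarrow>
          frac_kernel \<alpha> r * (heaviside (snd z) * k z * D j z r))) = J q" .
    qed
    finally show ?thesis .
  qed
  show "time_conv ?T (Phi_neg \<alpha>) \<psi> = ?Y"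
    unfolding time_conv_def
  proof (rule the_equality)
    show "\<forall>h. smooth_partition_of_unity h \<longrightarrow> ?term h sums ?Y" using sums by blast
    show "y = ?Y" if "\<forall>h. smooth_partition_of_unity h \<longrightarrow> ?term h sums y" for y
      by (rule sums_unique2[OF that[rule_format, OF smooth_partition_of_unity_unit_bump]
            sums[OF smooth_partition_of_unity_unit_bump]])
  qed
qed

section \<open>Integration by parts in the half-space\<close>

text \<open>The boundary terms at \<open>t = 0\<close> are the source of the distributions \<open>\<delta>'\<close> and \<open>\<delta>\<close> in the second
  time derivative of a function that is cut off at \<open>t = 0\<close>.\<close>

lemma half_line_Green:
  fixes v p q \<theta> \<theta>1 \<theta>2 :: "real \<Rightarrow> real"
  assumes v: "\<And>s. s \<ge> 0 \<Longrightarrow> (v has_real_derivative p s) (at s within {0..})"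
    and p: "\<And>s. s \<ge> 0 \<Longrightarrow> (p has_real_derivative q s) (at s within {0..})"
    and q: "continuous_on {0..} q"
    and \<theta>: "\<And>t. (\<theta> has_real_derivative \<theta>1 t) (at t)" "\<And>t. (\<theta>1 has_real_derivative \<theta>2 t) (at t)"
    and \<theta>2: "continuous_on UNIV \<theta>2"
    and R: "\<And>t. t \<ge> R \<Longrightarrow> \<theta> t = 0 \<and> \<theta>1 t = 0 \<and> \<theta>2 t = 0"
  shows "(\<integral>t. heaviside t * v t * \<theta>2 t \<partial>lborel) - (\<integral>t. heaviside t * q t * \<theta> t \<partial>lborel)
    = p 0 * \<theta> 0 - v 0 * \<theta>1 0"
proof -
  have cont: "continuous_on {0..} v" "continuous_on {0..} \<theta>" "continuous_on {0..} \<theta>2"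
    using v by (auto intro!: DERIV_continuous_on has_field_derivative_at_within[OF \<theta>(1)]
        continuous_on_subset[OF \<theta>2])
  have "integrable lborel (\<lambda>t. heaviside t * (v t * \<theta>2 t))"
    "integrable lborel (\<lambda>t. heaviside t * (q t * \<theta> t))"
    using R by (intro half_line_integrable[where R = R] continuous_on_mult cont q; simp)+
  then have "(\<integral>t. heaviside t * v t * \<theta>2 t \<partial>lborel) - (\<integral>t. heaviside t * q t * \<theta> t \<partial>lborel)
      = (\<integral>t. heaviside t * (v t * \<theta>2 t - q t * \<theta> t) \<partial>lborel)"
    by (simp add: right_diff_distrib mult.assoc)
  also have "\<dots> = - (v 0 * \<theta>1 0 - p 0 * \<theta> 0)"
  proof (rule half_line_FTC[where R = R])
    show "((\<lambda>t. v t * \<theta>1 t - p t * \<theta> t) has_real_derivative v t * \<theta>2 t - q t * \<theta> t) (at t within {0..})"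
      if "t \<ge> 0" for t
      using DERIV_diff[OF DERIV_mult[OF v[OF that] has_field_derivative_at_within[OF \<theta>(2)]]
          DERIV_mult[OF p[OF that] has_field_derivative_at_within[OF \<theta>(1)]]]
      by (simp add: algebra_simps)
    show "continuous_on {0..} (\<lambda>t. v t * \<theta>2 t - q t * \<theta> t)"
      by (intro continuous_on_diff continuous_on_mult cont q)
  qed (use R in simp_all)
  finally show ?thesis by simp
qed

text \<open>Tangential derivatives commute with the cutoff at \<open>t = 0\<close>: the integrand
  \<open>k \<partial>\<^sub>b\<^sup>2\<theta> - m \<theta>\<close> is the derivative of \<open>k \<partial>\<^sub>b\<theta> - l \<theta>\<close> in direction \<open>b\<close>, along which the Heaviside factor is
  constant.\<close>

lemma integral_half_space_Green:
  fixes k l m \<theta> :: "'a::euclidean_space \<times> real \<Rightarrow> real"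
  assumes cont: "continuous_on (UNIV \<times> {0..}) k" "continuous_on (UNIV \<times> {0..}) l"
      "continuous_on (UNIV \<times> {0..}) m"
    and k: "\<And>x t. t \<ge> 0 \<Longrightarrow> ((\<lambda>s. k (x + s *\<^sub>R b, t)) has_real_derivative l (x, t)) (at 0)"
    and l: "\<And>x t. t \<ge> 0 \<Longrightarrow> ((\<lambda>s. l (x + s *\<^sub>R b, t)) has_real_derivative m (x, t)) (at 0)"
    and \<theta>: "test_function \<theta>"
  shows "(\<integral>z. heaviside (snd z) * k z * dir_deriv (b, 0) (dir_deriv (b, 0) \<theta>) z \<partial>lborel)
    = (\<integral>z. heaviside (snd z) * m z * \<theta> z \<partial>lborel)"
proof -
  let ?\<theta>1 = "dir_deriv (b, 0) \<theta>" and ?\<theta>2 = "dir_deriv (b, 0) (dir_deriv (b, 0) \<theta>)"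
  have \<theta>1: "test_function ?\<theta>1" and \<theta>2: "test_function ?\<theta>2"
    using \<theta> by (auto intro: test_function_dir_deriv)
  define F where "F z = heaviside (snd z) * k z * ?\<theta>1 z - heaviside (snd z) * l z * \<theta> z" for z
  define D where "D z = heaviside (snd z) * k z * ?\<theta>2 z - heaviside (snd z) * m z * \<theta> z" for z
  note measurable_pieces = heaviside_test_function_measurable[OF cont(1) \<theta>1]
    heaviside_test_function_measurable[OF cont(2) \<theta>]
    heaviside_test_function_measurable[OF cont(1) \<theta>2]
    heaviside_test_function_measurable[OF cont(3) \<theta>]
  obtain M1 M2 M3 M4 where
    M: "\<And>z. \<bar>heaviside (snd z) * k z * ?\<theta>1 z\<bar> \<le> M1" "\<And>z. \<bar>heaviside (snd z) * l z * \<theta> z\<bar> \<le> M2"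
      "\<And>z. \<bar>heaviside (snd z) * k z * ?\<theta>2 z\<bar> \<le> M3" "\<And>z. \<bar>heaviside (snd z) * m z * \<theta> z\<bar> \<le> M4"
    using heaviside_test_function_bound[OF cont(1) \<theta>1] heaviside_test_function_bound[OF cont(2) \<theta>]
      heaviside_test_function_bound[OF cont(1) \<theta>2] heaviside_test_function_bound[OF cont(3) \<theta>]
    by blast
  obtain R0 where R0: "\<And>z. norm z \<ge> R0 \<Longrightarrow> \<theta> z = 0" using test_function_support[OF \<theta>] by blast
  obtain R1 where R1: "\<And>z. norm z \<ge> R1 \<Longrightarrow> ?\<theta>1 z = 0" using test_function_support[OF \<theta>1] by blast
  obtain R2 where R2: "\<And>z. norm z \<ge> R2 \<Longrightarrow> ?\<theta>2 z = 0" using test_function_support[OF \<theta>2] by blast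
  have "(\<integral>z. D z \<partial>lborel) = 0"
  proof (rule integral_dir_deriv_eq_0[where F = F and v = "(b, 0)" and M = "max (M1 + M2) (M3 + M4)"
        and R = "max R0 (max R1 R2)"])
    show "F \<in> borel_measurable borel" "D \<in> borel_measurable borel"
      unfolding F_def[abs_def] D_def[abs_def] by (intro borel_measurable_diff measurable_pieces)+
    show "\<bar>F z\<bar> \<le> max (M1 + M2) (M3 + M4)" for z
      using M(1)[of z] M(2)[of z] unfolding F_def by linarith
    show "\<bar>D z\<bar> \<le> max (M1 + M2) (M3 + M4)" for z
      using M(3)[of z] M(4)[of z] unfolding D_def by linarith
    show "F z = 0" "D z = 0" if "norm z \<ge> max R0 (max R1 R2)" for z
      using that R0[of z] R1[of z] R2[of z] by (simp_all add: F_def D_def)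
    show "((\<lambda>s. F (z + s *\<^sub>R (b, 0))) has_real_derivative D z) (at 0)" for z
    proof (cases "snd z \<ge> 0")
      case True
      obtain x t where z: "z = (x, t)" by (metis surj_pair)
      have t: "t \<ge> 0" using True z by simp
      have \<theta>d: "((\<lambda>s. \<theta> (x + s *\<^sub>R b, t)) has_real_derivative ?\<theta>1 (x, t)) (at 0)"
        "((\<lambda>s. ?\<theta>1 (x + s *\<^sub>R b, t)) has_real_derivative ?\<theta>2 (x, t)) (at 0)"
        using test_function_has_deriv[OF \<theta>, of "(x, t)" "(b, 0)"]
          test_function_has_deriv[OF \<theta>1, of "(x, t)" "(b, 0)"] by simp_all
      show ?thesis
        using DERIV_diff[OF DERIV_mult[OF k[OF t, of x] \<theta>d(2)] DERIV_mult[OF l[OF t, of x] \<theta>d(1)]] t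
        by (simp add: z F_def D_def heaviside_def algebra_simps)
    qed (simp add: F_def D_def heaviside_def)
  qed
  then show ?thesis
    unfolding D_def
    using heaviside_test_function_integrable[OF cont(1) \<theta>2] heaviside_test_function_integrable[OF cont(3) \<theta>]
    by simp
qed

text \<open>The normal direction, where the cutoff does contribute: \<open>half_line_Green\<close> integrated over \<open>x\<close>.\<close>

lemma integral_half_space_time_Green:
  fixes k l m \<theta> :: "'a::euclidean_space \<times> real \<Rightarrow> real"
  assumes cont: "continuous_on (UNIV \<times> {0..}) k" "continuous_on (UNIV \<times> {0..}) m"
    and k: "\<And>x t. t \<ge> 0 \<Longrightarrow> ((\<lambda>s. k (x, s)) has_real_derivative l (x, t)) (at t within {0..})"
    and l: "\<And>x t. t \<ge> 0 \<Longrightarrow> ((\<lambda>s. l (x, s)) has_real_derivative m (x, t)) (at t within {0..})"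
    and \<theta>: "test_function \<theta>"
  shows "(\<integral>z. heaviside (snd z) * k z * dir_deriv (0, 1) (dir_deriv (0, 1) \<theta>) z \<partial>lborel)
    = (\<integral>x. l (x, 0) * \<theta> (x, 0) - k (x, 0) * dir_deriv (0, 1) \<theta> (x, 0) \<partial>lborel)
      + (\<integral>z. heaviside (snd z) * m z * \<theta> z \<partial>lborel)"
proof -
  let ?\<theta>1 = "dir_deriv (0, 1) \<theta>" and ?\<theta>2 = "dir_deriv (0, 1) (dir_deriv (0, 1) \<theta>)"
  have \<theta>1: "test_function ?\<theta>1" and \<theta>2: "test_function ?\<theta>2"
    using \<theta> by (auto intro: test_function_dir_deriv)
  obtain R0 where R0: "\<And>z. norm z \<ge> R0 \<Longrightarrow> \<theta> z = 0" using test_function_support[OF \<theta>] by blast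
  obtain R1 where R1: "\<And>z. norm z \<ge> R1 \<Longrightarrow> ?\<theta>1 z = 0" using test_function_support[OF \<theta>1] by blast
  obtain R2 where R2: "\<And>z. norm z \<ge> R2 \<Longrightarrow> ?\<theta>2 z = 0" using test_function_support[OF \<theta>2] by blast
  let ?I1 = "\<lambda>x. \<integral>t. heaviside t * k (x, t) * ?\<theta>2 (x, t) \<partial>lborel"
  let ?I2 = "\<lambda>x. \<integral>t. heaviside t * m (x, t) * \<theta> (x, t) \<partial>lborel"
  have slice: "?I1 x - ?I2 x = l (x, 0) * \<theta> (x, 0) - k (x, 0) * ?\<theta>1 (x, 0)" for x
  proof (rule half_line_Green[where R = "max R0 (max R1 R2)" and p = "\<lambda>t. l (x, t)"])
    show "continuous_on {0..} (\<lambda>t. m (x, t))"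
      by (rule continuous_on_compose2[OF cont(2)]) (auto intro!: continuous_intros)
    show "continuous_on UNIV (\<lambda>t. ?\<theta>2 (x, t))"
      by (rule continuous_on_compose2[OF test_function_continuous[OF \<theta>2]]) (auto intro!: continuous_intros)
    show "\<theta> (x, t) = 0 \<and> ?\<theta>1 (x, t) = 0 \<and> ?\<theta>2 (x, t) = 0" if "t \<ge> max R0 (max R1 R2)" for t
      using that norm_snd_le[where x = x and y = t] by (intro conjI R0 R1 R2) auto
  qed (use k l test_function_time_deriv[OF \<theta>] test_function_time_deriv[OF \<theta>1] in auto)
  note i1 = lborel_integral_time_slices[OF heaviside_test_function_integrable[OF cont(1) \<theta>2]]
  note i2 = lborel_integral_time_slices[OF heaviside_test_function_integrable[OF cont(2) \<theta>]]
  have "(\<integral>x. ?I1 x \<partial>lborel) - (\<integral>x. ?I2 x \<partial>lborel) = (\<integral>x. ?I1 x - ?I2 x \<partial>lborel)"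
    using i1(1) i2(1) by simp
  then show ?thesis unfolding slice using i1(2) i2(2) by simp
qed

section \<open>Smooth solutions of the initial value problem\<close>

lemma Ck_on_3_derivatives:
  assumes "Ck_on 3 S w"
  obtains w1 w2 w3 where "\<And>z. z \<in> S \<Longrightarrow> (w has_derivative w1 z) (at z within S)"
    and "\<And>v z. z \<in> S \<Longrightarrow> ((\<lambda>z. w1 z v) has_derivative w2 v z) (at z within S)"
    and "\<And>v v' z. z \<in> S \<Longrightarrow> ((\<lambda>z. w2 v z v') has_derivative w3 v v' z) (at z within S)"
proof -
  have "Ck_on (Suc (Suc (Suc 0))) S w" using assms by (simp add: eval_nat_numeral)
  then obtain w1 where w1: "\<forall>z\<in>S. (w has_derivative w1 z) (at z within S)"
    "\<forall>v. Ck_on (Suc (Suc 0)) S (\<lambda>z. w1 z v)" by (subst (asm) Ck_on.simps(2)) blast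
  from w1(2) have "\<forall>v. \<exists>w2. (\<forall>z\<in>S. ((\<lambda>z. w1 z v) has_derivative w2 z) (at z within S)) \<and>
      (\<forall>v'. Ck_on (Suc 0) S (\<lambda>z. w2 z v'))" by (subst (asm) Ck_on.simps(2))
  then obtain w2 where w2: "\<forall>v. \<forall>z\<in>S. ((\<lambda>z. w1 z v) has_derivative w2 v z) (at z within S)"
      "\<forall>v v'. Ck_on (Suc 0) S (\<lambda>z. w2 v z v')" by metis
  from w2(2) have "\<forall>v v'. \<exists>w3. (\<forall>z\<in>S. ((\<lambda>z. w2 v z v') has_derivative w3 z) (at z within S))"
    by (subst (asm) Ck_on.simps(2)) blast
  then obtain w3 where "\<forall>v v'. \<forall>z\<in>S. ((\<lambda>z. w2 v z v') has_derivative w3 v v' z) (at z within S)"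
    by metis
  with w1 w2 show ?thesis by (intro that[of w1 w2 w3]) blast+
qed

text \<open>Restriction of a derivative within \<open>S\<close> to a line. The parameter set \<open>T\<close> covers one-sided
  derivatives at the boundary as well as two-sided ones tangential to it.\<close>

lemma has_real_derivative_along_line:
  assumes "(w has_derivative w') (at z within S)" and "\<And>s. s \<in> T \<Longrightarrow> z + (s - t) *\<^sub>R v \<in> S"
  shows "((\<lambda>s. w (z + (s - t) *\<^sub>R v)) has_real_derivative w' v) (at t within T)"
proof -
  have "((\<lambda>s. z + (s - t) *\<^sub>R v) has_derivative (\<lambda>s. s *\<^sub>R v)) (at t within T)"
    by (auto intro!: derivative_eq_intros)
  moreover have "(w has_derivative w') (at (z + (t - t) *\<^sub>R v) within (\<lambda>s. z + (s - t) *\<^sub>R v) ` T)"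
    using assms by (auto intro: has_derivative_subset)
  ultimately have "((\<lambda>s. w (z + (s - t) *\<^sub>R v)) has_derivative (\<lambda>s. w' (s *\<^sub>R v))) (at t within T)"
    by (rule has_derivative_in_compose)
  also have "(\<lambda>s. w' (s *\<^sub>R v)) = (*) (w' v)"
    using linear_scale[OF has_derivative_linear[OF assms(1)]] by (auto simp: mult.commute)
  finally show ?thesis by (simp add: has_field_derivative_def)
qed

lemma half_space_time_derivative:
  fixes w :: "'a::euclidean_space \<times> real \<Rightarrow> real"
  assumes "(w has_derivative w') (at (x, t) within UNIV \<times> {0..})"
  shows "((\<lambda>s. w (x, s)) has_real_derivative w' (0, 1)) (at t within {0..})"
  using has_real_derivative_along_line[OF assms, of "{0..}" t "(0, 1)"] by simp

lemma half_space_space_derivative: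
  fixes w :: "'a::euclidean_space \<times> real \<Rightarrow> real"
  assumes "(w has_derivative w') (at (x, t) within UNIV \<times> {0..})" "t \<ge> 0"
  shows "((\<lambda>s. w (x + s *\<^sub>R b, t)) has_real_derivative w' (b, 0)) (at 0)"
  using has_real_derivative_along_line[OF assms(1), of UNIV 0 "(b, 0)"] assms(2) by simp

lemma within_Ici_derivative_imp_deriv:
  assumes "(v has_real_derivative d) (at t within {0..})" "t > 0"
  shows "deriv v t = d"
proof -
  have "at t within {0..} = at t" using assms(2) by (intro at_within_interior) auto
  with assms show ?thesis by (auto intro: DERIV_imp_deriv)
qed

text \<open>The solution in terms of its first and second derivatives \<open>w1\<close> and \<open>w2\<close> on the closed half-space.
  The last conclusion is the essential one: \<open>u\<^sub>t\<^sub>t - c\<^sup>2 \<Delta>u\<close> is smooth up to \<open>t = 0\<close>, so the equation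
  forces \<open>a\<close> times the Caputo derivative to be so, too. Its leading term is
  \<open>a g t\<^sup>1\<^sup>-\<^sup>\<alpha> / \<Gamma>(2 - \<alpha>)\<close>, whence \<open>a g = 0\<close>. As the Caputo derivative tends to 0, both
  sides of the equation vanish at \<open>t = 0\<close>, which is why it is stated for \<open>t \<ge> 0\<close>.\<close>

lemma smooth_ivp_solution_compatibility:
  fixes c a f g :: "real^'n \<Rightarrow> real"
  assumes sol: "smooth_ivp_solution c a \<alpha> f g u"
    and \<alpha>: "0 < \<alpha>" "\<alpha> < 1"
  obtains w1 :: "(real^'n) \<times> real \<Rightarrow> (real^'n) \<times> real \<Rightarrow> real"
    and w2 :: "(real^'n) \<times> real \<Rightarrow> (real^'n) \<times> real \<Rightarrow> (real^'n) \<times> real \<Rightarrow> real"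
  where
    "continuous_on (UNIV \<times> {0..}) (\<lambda>(x, t). u x t)"
    "\<And>v. continuous_on (UNIV \<times> {0..}) (\<lambda>z. w1 z v)"
    "\<And>v v'. continuous_on (UNIV \<times> {0..}) (\<lambda>z. w2 v z v')"
    "\<And>x t. t \<ge> 0 \<Longrightarrow> ((\<lambda>s. u x s) has_real_derivative w1 (x, t) (0, 1)) (at t within {0..})"
    "\<And>v x t. t \<ge> 0 \<Longrightarrow> ((\<lambda>s. w1 (x, s) v) has_real_derivative w2 v (x, t) (0, 1)) (at t within {0..})"
    "\<And>b x t. t \<ge> 0 \<Longrightarrow> ((\<lambda>s. u (x + s *\<^sub>R b) t) has_real_derivative w1 (x, t) (b, 0)) (at 0)"
    "\<And>b v x t. t \<ge> 0 \<Longrightarrow> ((\<lambda>s. w1 (x + s *\<^sub>R b, t) v) has_real_derivative w2 v (x, t) (b, 0)) (at 0)"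
    "\<And>x t. t \<ge> 0 \<Longrightarrow> w2 (0, 1) (x, t) (0, 1) - (c x)\<^sup>2 * (\<Sum>b\<in>Basis. w2 (b, 0) (x, t) (b, 0))
        = - (a x / Gamma (1 - \<alpha>)) * (LINT s:{0<..<t}|lborel. w1 (x, s) (0, 1) / (t - s) powr \<alpha>)"
    "\<And>x. w1 (x, 0) (0, 1) = g x"
    "\<And>x. a x * g x = 0"
proof -
  let ?S = "UNIV \<times> {0..} :: ((real^'n) \<times> real) set"
  have "Ck_on 3 ?S (\<lambda>(x, t). u x t)"
    using sol by (auto simp: smooth_ivp_solution_def smooth_on_def)
  then obtain w1 w2 w3 where
    w1: "\<And>z. z \<in> ?S \<Longrightarrow> ((\<lambda>(x, t). u x t) has_derivative w1 z) (at z within ?S)"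
    and w2: "\<And>v z. z \<in> ?S \<Longrightarrow> ((\<lambda>z. w1 z v) has_derivative w2 v z) (at z within ?S)"
    and w3: "\<And>v v' z. z \<in> ?S \<Longrightarrow> ((\<lambda>z. w2 v z v') has_derivative w3 v v' z) (at z within ?S)"
    using Ck_on_3_derivatives by blast
  have cont: "continuous_on ?S (\<lambda>(x, t). u x t)" "\<And>v. continuous_on ?S (\<lambda>z. w1 z v)"
    "\<And>v v'. continuous_on ?S (\<lambda>z. w2 v z v')"
    using w1 w2 w3 by (blast intro: has_derivative_continuous_on)+
  have t1: "((\<lambda>s. u x s) has_real_derivative w1 (x, t) (0, 1)) (at t within {0..})"
    and t2: "((\<lambda>s. w1 (x, s) v) has_real_derivative w2 v (x, t) (0, 1)) (at t within {0..})"
    and t3: "((\<lambda>s. w2 v (x, s) v') has_real_derivative w3 v v' (x, t) (0, 1)) (at t within {0..})"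
    and s1: "((\<lambda>s. u (x + s *\<^sub>R b) t) has_real_derivative w1 (x, t) (b, 0)) (at 0)"
    and s2: "((\<lambda>s. w1 (x + s *\<^sub>R b, t) v) has_real_derivative w2 v (x, t) (b, 0)) (at 0)"
    if "t \<ge> 0" for x t v v' b
    using half_space_time_derivative[OF w1[of "(x, t)"]] half_space_time_derivative[OF w2[of "(x, t)" v]]
      half_space_time_derivative[OF w3[of "(x, t)" v v']]
      half_space_space_derivative[OF w1[of "(x, t)"]] half_space_space_derivative[OF w2[of "(x, t)" v]] that
    by auto
  have deriv1: "deriv (u x) t = w1 (x, t) (0, 1)" if "t > 0" for x t
    using that t1 by (intro within_Ici_derivative_imp_deriv) auto
  have deriv2: "deriv (deriv (u x)) t = w2 (0, 1) (x, t) (0, 1)" if "t > 0" for x t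
  proof -
    have "eventually (\<lambda>s. deriv (u x) s = w1 (x, s) (0, 1)) (nhds t)"
      using deriv1 that by (intro eventually_nhds[THEN iffD2] exI[of _ "{0<..}"]) auto
    then have "deriv (deriv (u x)) t = deriv (\<lambda>s. w1 (x, s) (0, 1)) t"
      by (rule deriv_cong_ev) simp
    then show ?thesis using that t2 by (simp add: within_Ici_derivative_imp_deriv)
  qed
  have lap: "laplacian (\<lambda>y. u y t) x = (\<Sum>b\<in>Basis. w2 (b, 0) (x, t) (b, 0))" if "t \<ge> 0" for x t
  proof -
    have "dir_deriv b (\<lambda>y. u y t) = (\<lambda>y. w1 (y, t) (b, 0))" for b
      unfolding dir_deriv_def using s1[OF that] by (auto intro: DERIV_imp_deriv)
    moreover have "dir_deriv b (\<lambda>y. w1 (y, t) (b, 0)) x = w2 (b, 0) (x, t) (b, 0)" for b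
      unfolding dir_deriv_def using s2[OF that] by (auto intro: DERIV_imp_deriv)
    ultimately show ?thesis by (simp add: laplacian_def)
  qed
  have pde_pos: "w2 (0, 1) (x, t) (0, 1) - (c x)\<^sup>2 * (\<Sum>b\<in>Basis. w2 (b, 0) (x, t) (b, 0))
      = - (a x / Gamma (1 - \<alpha>)) * (LINT s:{0<..<t}|lborel. w1 (x, s) (0, 1) / (t - s) powr \<alpha>)"
    if "t > 0" for x t
  proof -
    have "(LINT s:{0<..<t}|lborel. deriv (u x) s / (t - s) powr \<alpha>)
        = (LINT s:{0<..<t}|lborel. w1 (x, s) (0, 1) / (t - s) powr \<alpha>)"
      using deriv1 by (intro set_lebesgue_integral_cong) auto
    moreover have "deriv (deriv (u x)) t - (c x)\<^sup>2 * laplacian (\<lambda>y. u y t) x + a x * caputo \<alpha> (u x) t = 0"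
      using sol that by (simp add: smooth_ivp_solution_def)
    ultimately show ?thesis
      using that by (simp add: deriv2 lap caputo_def algebra_simps)
  qed
  have initial: "w1 (x, 0) (0, 1) = g x" for x
  proof -
    have "(u x has_real_derivative g x) (at 0 within {0..})"
      using sol by (simp add: smooth_ivp_solution_def)
    then show ?thesis
      using t1[of 0 x] tendsto_unique[OF trivial_limit_at_right_real]
      unfolding has_field_derivative_iff at_within_Ici_at_right by auto
  qed
  \<comment> \<open>Three orders of smoothness make the left-hand side of \<open>pde_pos\<close> differentiable in time up to
    \<open>t = 0\<close>.\<close>
  have compat: "- (a x / Gamma (1 - \<alpha>)) * w1 (x, 0) (0, 1) = 0"
    "w2 (0, 1) (x, 0) (0, 1) - (c x)\<^sup>2 * (\<Sum>b\<in>Basis. w2 (b, 0) (x, 0) (b, 0)) = 0" for x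
  proof -
    have G: "((\<lambda>t. w2 (0, 1) (x, t) (0, 1) - (c x)\<^sup>2 * (\<Sum>b\<in>Basis. w2 (b, 0) (x, t) (b, 0)))
        has_real_derivative w3 (0, 1) (0, 1) (x, 0) (0, 1)
          - (c x)\<^sup>2 * (\<Sum>b\<in>Basis. w3 (b, 0) (b, 0) (x, 0) (0, 1))) (at 0 within {0..})"
      by (intro DERIV_diff DERIV_cmult DERIV_sum t3) auto
    have p: "continuous_on {0..} (\<lambda>t. w1 (x, t) (0, 1))"
      using t2 by (intro DERIV_continuous_on) auto
    show "- (a x / Gamma (1 - \<alpha>)) * w1 (x, 0) (0, 1) = 0"
      "w2 (0, 1) (x, 0) (0, 1) - (c x)\<^sup>2 * (\<Sum>b\<in>Basis. w2 (b, 0) (x, 0) (b, 0)) = 0"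
      by (rule caputo_regular_imp_zero_velocity[OF \<alpha> p G pde_pos]; assumption)+
  qed
  have pde: "w2 (0, 1) (x, t) (0, 1) - (c x)\<^sup>2 * (\<Sum>b\<in>Basis. w2 (b, 0) (x, t) (b, 0))
      = - (a x / Gamma (1 - \<alpha>)) * (LINT s:{0<..<t}|lborel. w1 (x, s) (0, 1) / (t - s) powr \<alpha>)"
    if "t \<ge> 0" for x t
    using pde_pos[of t x] compat(2)[of x] that by (cases "t = 0") (auto simp: set_lebesgue_integral_def)
  have ag: "a x * g x = 0" for x
  proof -
    have "Gamma (1 - \<alpha>) > 0" using \<alpha> by (intro Gamma_real_pos) simp
    with compat(1)[of x] show ?thesis by (auto simp: initial)
  qed
  show ?thesis by (rule that[of w1 w2]; fact cont t1 t2 s1 s2 pde initial ag)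
qed

section \<open>The distributional equation\<close>

theorem lemma2:
  fixes c a f :: "real^'n \<Rightarrow> real"
    and c0 \<alpha> :: real
    and u :: "real^'n \<Rightarrow> real \<Rightarrow> real"
    and U :: "((real^'n) \<times> real) functional"
  assumes "smooth_on UNIV c" and "smooth_on UNIV a"
    and "c0 > 0" and "\<And>x. c x \<ge> c0" and "\<And>x. a x \<ge> 0"
    and "0 < \<alpha>" and "\<alpha> < 1"
    and "smooth_ivp_solution c a \<alpha> f (\<lambda>x. - a x / Gamma (2 - \<alpha>) * f x) u"
  defines "U \<equiv> dist_of (\<lambda>(x, t). heaviside t * u x t)"
  shows "dist_eq
           (\<lambda>\<phi>. dist_dt (dist_dt U) \<phi>
                - dist_mult (\<lambda>(x, t). (c x)\<^sup>2) (dist_laplacian_x U) \<phi>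
                + attenuation a \<alpha> U \<phi>)
           (dist_tensor (dist_of f) (dist_deriv 1 (dirac 0)))
       \<and> vanishes_on (UNIV \<times> {..<0}) U"
proof
  let ?S = "UNIV \<times> {0..} :: ((real^'n) \<times> real) set"
  note sol = assms(8) and \<alpha> = assms(6,7)
  obtain w1 :: "(real^'n) \<times> real \<Rightarrow> (real^'n) \<times> real \<Rightarrow> real"
    and w2 :: "(real^'n) \<times> real \<Rightarrow> (real^'n) \<times> real \<Rightarrow> (real^'n) \<times> real \<Rightarrow> real"
  where
    cont: "continuous_on ?S (\<lambda>(x, t). u x t)" "\<And>v. continuous_on ?S (\<lambda>z. w1 z v)"
      "\<And>v v'. continuous_on ?S (\<lambda>z. w2 v z v')"
    and t1: "\<And>x t. t \<ge> 0 \<Longrightarrow> ((\<lambda>s. u x s) has_real_derivative w1 (x, t) (0, 1)) (at t within {0..})"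
    and t2: "\<And>v x t. t \<ge> 0 \<Longrightarrow> ((\<lambda>s. w1 (x, s) v) has_real_derivative w2 v (x, t) (0, 1)) (at t within {0..})"
    and s1: "\<And>b x t. t \<ge> 0 \<Longrightarrow> ((\<lambda>s. u (x + s *\<^sub>R b) t) has_real_derivative w1 (x, t) (b, 0)) (at 0)"
    and s2: "\<And>b v x t. t \<ge> 0 \<Longrightarrow> ((\<lambda>s. w1 (x + s *\<^sub>R b, t) v) has_real_derivative w2 v (x, t) (b, 0)) (at 0)"
    and pde: "\<And>x t. t \<ge> 0 \<Longrightarrow> w2 (0, 1) (x, t) (0, 1) - (c x)\<^sup>2 * (\<Sum>b\<in>Basis. w2 (b, 0) (x, t) (b, 0))
        = - (a x / Gamma (1 - \<alpha>)) * (LINT s:{0<..<t}|lborel. w1 (x, s) (0, 1) / (t - s) powr \<alpha>)"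
    and initial: "\<And>x. w1 (x, 0) (0, 1) = - a x / Gamma (2 - \<alpha>) * f x"
    and compat: "\<And>x. a x * (- a x / Gamma (2 - \<alpha>) * f x) = 0"
    by (rule smooth_ivp_solution_compatibility[OF sol \<alpha>]) blast
  have u0: "u x 0 = f x" for x using sol by (simp add: smooth_ivp_solution_def)
  have Gamma_pos: "Gamma (1 - \<alpha>) > 0" "Gamma (2 - \<alpha>) > 0" using \<alpha> by (auto intro!: Gamma_real_pos)
  \<comment> \<open>Compatibility with the prescribed velocity reads \<open>a\<^sup>2 f = 0\<close>.\<close>
  have af: "a x = 0 \<or> f x = 0" for x using compat[of x] Gamma_pos by auto
  then have velocity_0: "w1 (x, 0) (0, 1) = 0" for x using initial[of x] by auto

  define k :: "(real^'n) \<times> real \<Rightarrow> real" where "k = (\<lambda>(x, t). u x t)"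
  define utt where "utt z = w2 (0, 1) z (0, 1)" for z
  define lap where "lap z = (\<Sum>b\<in>Basis. w2 (b, 0) z (b, 0))" for z
  have k: "continuous_on ?S k" and utt: "continuous_on ?S utt" and lap: "continuous_on ?S lap"
    using cont unfolding k_def utt_def[abs_def] lap_def[abs_def] by (auto intro!: continuous_on_sum)
  have U: "U = dist_of (\<lambda>z. heaviside (snd z) * k z)"
    by (simp add: U_def k_def case_prod_unfold)

  have smooth_fst: "smooth_on UNIV (\<lambda>z::(real^'n) \<times> real. e (fst z))" if "smooth_on UNIV e" for e
  proof -
    have "Ck_on m UNIV (\<lambda>z::(real^'n) \<times> real. e (fst z + 0))" for m
      using that by (intro Ck_on_affine_comp[OF bounded_linear_fst]) (simp add: smooth_on_def)
    then show ?thesis by (simp add: smooth_on_def)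
  qed

  show "dist_eq (\<lambda>\<phi>. dist_dt (dist_dt U) \<phi>
                - dist_mult (\<lambda>(x, t). (c x)\<^sup>2) (dist_laplacian_x U) \<phi> + attenuation a \<alpha> U \<phi>)
           (dist_tensor (dist_of f) (dist_deriv 1 (dirac 0)))"
    unfolding dist_eq_def
  proof (intro allI impI)
    fix \<phi> :: "(real^'n) \<times> real \<Rightarrow> real" assume \<phi>: "test_function \<phi>"
    define \<theta> where "\<theta> z = (c (fst z))\<^sup>2 * \<phi> z" for z :: "(real^'n) \<times> real"
    define \<psi> where "\<psi> z = a (fst z) * \<phi> z" for z :: "(real^'n) \<times> real"
    have \<theta>: "test_function \<theta>"
      unfolding \<theta>_def[abs_def] power2_eq_square
      by (intro test_function_mult smooth_on_mult smooth_fst assms(1) \<phi>)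
    have \<psi>: "test_function \<psi>"
      unfolding \<psi>_def[abs_def] by (intro test_function_mult smooth_fst assms(2) \<phi>)
    have int_utt: "integrable lborel (\<lambda>z. heaviside (snd z) * utt z * \<phi> z)"
      by (rule heaviside_test_function_integrable[OF utt \<phi>])
    have int_lap: "integrable lborel (\<lambda>z. heaviside (snd z) * lap z * \<theta> z)"
      by (rule heaviside_test_function_integrable[OF lap \<theta>])

    have "dist_dt (dist_dt U) \<phi>
        = (\<integral>z. heaviside (snd z) * k z * dir_deriv (0, 1) (dir_deriv (0, 1) \<phi>) z \<partial>lborel)"
      by (simp add: dist_dt_def dist_deriv_def U dist_of_def)
    also have "\<dots> = (\<integral>x. w1 (x, 0) (0, 1) * \<phi> (x, 0) - k (x, 0) * dir_deriv (0, 1) \<phi> (x, 0) \<partial>lborel)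
        + (\<integral>z. heaviside (snd z) * utt z * \<phi> z \<partial>lborel)"
      by (rule integral_half_space_time_Green[OF k utt _ _ \<phi>])
        (auto simp: k_def utt_def intro: t1 t2)
    also have "\<dots> = (\<integral>x. - (f x * dir_deriv (0, 1) \<phi> (x, 0)) \<partial>lborel)
        + (\<integral>z. heaviside (snd z) * utt z * \<phi> z \<partial>lborel)"
      by (simp add: velocity_0 k_def u0)
    finally have wave_time: "dist_dt (dist_dt U) \<phi> = (\<integral>x. - (f x * dir_deriv (0, 1) \<phi> (x, 0)) \<partial>lborel)
        + (\<integral>z. heaviside (snd z) * utt z * \<phi> z \<partial>lborel)" .

    have "dist_mult (\<lambda>(x, t). (c x)\<^sup>2) (dist_laplacian_x U) \<phi>
        = (\<Sum>b\<in>Basis. \<integral>z. heaviside (snd z) * k z * dir_deriv (b, 0) (dir_deriv (b, 0) \<theta>) z \<partial>lborel)"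
      by (simp add: dist_mult_def dist_laplacian_x_def dist_deriv_def U dist_of_def \<theta>_def[abs_def]
          case_prod_unfold)
    also have "\<dots> = (\<Sum>b\<in>Basis. \<integral>z. heaviside (snd z) * w2 (b, 0) z (b, 0) * \<theta> z \<partial>lborel)"
    proof (rule sum.cong[OF refl])
      fix b :: "real^'n"
      show "(\<integral>z. heaviside (snd z) * k z * dir_deriv (b, 0) (dir_deriv (b, 0) \<theta>) z \<partial>lborel)
          = (\<integral>z. heaviside (snd z) * w2 (b, 0) z (b, 0) * \<theta> z \<partial>lborel)"
        by (rule integral_half_space_Green[OF k cont(2) cont(3) _ _ \<theta>])
          (auto simp: k_def intro: s1 s2)
    qed
    also have "\<dots> = (\<integral>z. heaviside (snd z) * lap z * \<theta> z \<partial>lborel)"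
      using heaviside_test_function_integrable[OF cont(3) \<theta>]
      by (subst Bochner_Integration.integral_sum[symmetric])
        (auto simp: lap_def sum_distrib_left sum_distrib_right)
    finally have wave_space: "dist_mult (\<lambda>(x, t). (c x)\<^sup>2) (dist_laplacian_x U) \<phi>
        = (\<integral>z. heaviside (snd z) * lap z * \<theta> z \<partial>lborel)" .

    \<comment> \<open>On each line \<open>x = const\<close> the memory term becomes the Caputo derivative, which the equation
      expresses by the local terms.\<close>
    let ?J = "\<lambda>(z, r). frac_kernel \<alpha> r * (heaviside (snd z) * k z * dir_deriv (0, 1) \<psi> (fst z, snd z + r))"
    let ?\<psi>' = "dir_deriv (0, 1) \<psi>"
    have \<psi>': "test_function ?\<psi>'" using \<psi> by (rule test_function_dir_deriv)
    note J = time_conv_Phi_neg[OF \<alpha>(2) k \<psi>]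
    have J1: "(\<integral>r. ?J (z, r) \<partial>lborel)
        = heaviside (snd z) * k z * (\<integral>r. frac_kernel \<alpha> r * ?\<psi>' (fst z, snd z + r) \<partial>lborel)" for z
      by (subst integral_mult_right_zero[symmetric]) (simp add: mult_ac)
    have "integral\<^sup>L (lborel \<Otimes>\<^sub>M lborel) ?J
        = (\<integral>x. (\<integral>t. (\<integral>r. ?J ((x, t), r) \<partial>lborel) \<partial>lborel) \<partial>lborel)"
      using lborel_integral_time_slices(2)[OF lborel_pair.integrable_fst'[OF J(1)]]
        lborel_pair.integral_fst'[OF J(1)] by simp
    also have "\<dots> = (\<integral>x. (\<integral>t. Gamma (1 - \<alpha>) * (heaviside t * utt (x, t) * \<phi> (x, t)
        - heaviside t * lap (x, t) * \<theta> (x, t)) \<partial>lborel) \<partial>lborel)"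
    proof (rule Bochner_Integration.integral_cong[OF refl])
      fix x
      let ?L = "\<lambda>t. LINT s:{0<..<t}|lborel. w1 (x, s) (0, 1) / (t - s) powr \<alpha>"
      obtain R where R: "\<And>z. norm z \<ge> R \<Longrightarrow> \<psi> z = 0" using test_function_support[OF \<psi>] by blast
      obtain R' where R': "\<And>z. norm z \<ge> R' \<Longrightarrow> ?\<psi>' z = 0" using test_function_support[OF \<psi>'] by blast
      obtain N where N: "\<And>z. \<bar>\<psi> z\<bar> \<le> N" using test_function_bounded[OF \<psi>] by blast
      obtain N' where N': "\<And>z. \<bar>?\<psi>' z\<bar> \<le> N'" using test_function_bounded[OF \<psi>'] by blast
      have "(\<integral>t. (\<integral>r. ?J ((x, t), r) \<partial>lborel) \<partial>lborel)
          = (\<integral>t. heaviside t * u x t * (\<integral>r. frac_kernel \<alpha> r * ?\<psi>' (x, t + r) \<partial>lborel) \<partial>lborel)"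
        unfolding J1 by (simp add: k_def)
      also have "\<dots> = - (u x 0 * (\<integral>r. frac_kernel \<alpha> r * \<psi> (x, r) \<partial>lborel))
          - (\<integral>t. heaviside t * \<psi> (x, t) * ?L t \<partial>lborel)"
      proof (rule fractional_integration_by_parts[where R = "max R R'" and N = "max N N'"])
        show "continuous_on {0..} (\<lambda>t. w1 (x, t) (0, 1))"
          using t2 by (intro DERIV_continuous_on) auto
        show "continuous_on UNIV (\<lambda>t. ?\<psi>' (x, t))"
          by (rule continuous_on_compose2[OF test_function_continuous[OF \<psi>']]) (auto intro!: continuous_intros)
        show "\<psi> (x, t) = 0" "?\<psi>' (x, t) = 0" if "max R R' \<le> \<bar>t\<bar>" for t
          using that norm_snd_le[where x = x and y = t] by (auto intro!: R R')
        show "\<bar>\<psi> (x, t)\<bar> \<le> max N N'" "\<bar>?\<psi>' (x, t)\<bar> \<le> max N N'" for t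
          using N[of "(x, t)"] N'[of "(x, t)"] by linarith+
      qed (use \<alpha>(2) t1 test_function_time_deriv[OF \<psi>] in auto)
      \<comment> \<open>The contribution of the initial value carries the factor \<open>a f\<close>.\<close>
      also have "u x 0 * (\<integral>r. frac_kernel \<alpha> r * \<psi> (x, r) \<partial>lborel) = 0"
        using af[of x] by (auto simp: \<psi>_def u0)
      also have "- 0 - (\<integral>t. heaviside t * \<psi> (x, t) * ?L t \<partial>lborel)
          = (\<integral>t. - (heaviside t * \<psi> (x, t) * ?L t) \<partial>lborel)"
        by simp
      also have "\<dots> = (\<integral>t. Gamma (1 - \<alpha>) * (heaviside t * utt (x, t) * \<phi> (x, t)
          - heaviside t * lap (x, t) * \<theta> (x, t)) \<partial>lborel)"
      proof (rule Bochner_Integration.integral_cong[OF refl])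
        fix t
        show "- (heaviside t * \<psi> (x, t) * ?L t) = Gamma (1 - \<alpha>) *
            (heaviside t * utt (x, t) * \<phi> (x, t) - heaviside t * lap (x, t) * \<theta> (x, t))"
        proof (cases "t \<ge> 0")
          case True
          have "Gamma (1 - \<alpha>) * (utt (x, t) - (c x)\<^sup>2 * lap (x, t)) = - (a x * ?L t)"
            unfolding utt_def lap_def pde[OF True] using Gamma_pos(1) by simp
          then have "- (a x * ?L t) * \<phi> (x, t) = Gamma (1 - \<alpha>) * (utt (x, t) - (c x)\<^sup>2 * lap (x, t)) * \<phi> (x, t)"
            by simp
          then show ?thesis using True by (simp add: heaviside_def \<psi>_def \<theta>_def algebra_simps)
        qed (simp add: heaviside_def)
      qed
      finally show "(\<integral>t. (\<integral>r. ?J ((x, t), r) \<partial>lborel) \<partial>lborel)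
          = (\<integral>t. Gamma (1 - \<alpha>) * (heaviside t * utt (x, t) * \<phi> (x, t)
            - heaviside t * lap (x, t) * \<theta> (x, t)) \<partial>lborel)" .
    qed
    also have "\<dots> = Gamma (1 - \<alpha>) * (\<integral>x. (\<integral>t. heaviside t * utt (x, t) * \<phi> (x, t)
        - heaviside t * lap (x, t) * \<theta> (x, t) \<partial>lborel) \<partial>lborel)"
      by simp
    also have "(\<integral>x. (\<integral>t. heaviside t * utt (x, t) * \<phi> (x, t)
        - heaviside t * lap (x, t) * \<theta> (x, t) \<partial>lborel) \<partial>lborel)
      = (\<integral>z. heaviside (snd z) * utt z * \<phi> z - heaviside (snd z) * lap z * \<theta> z \<partial>lborel)"
      using lborel_integral_time_slices(2)[OF Bochner_Integration.integrable_diff[OF int_utt int_lap]] by simp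
    also have "\<dots> = (\<integral>z. heaviside (snd z) * utt z * \<phi> z \<partial>lborel) - (\<integral>z. heaviside (snd z) * lap z * \<theta> z \<partial>lborel)"
      by (rule Bochner_Integration.integral_diff[OF int_utt int_lap])
    finally have J_eq: "integral\<^sup>L (lborel \<Otimes>\<^sub>M lborel) ?J = Gamma (1 - \<alpha>) *
        ((\<integral>z. heaviside (snd z) * utt z * \<phi> z \<partial>lborel) - (\<integral>z. heaviside (snd z) * lap z * \<theta> z \<partial>lborel))" .
    have "attenuation a \<alpha> U \<phi> = time_conv U (Phi_neg \<alpha>) \<psi>"
      by (simp add: attenuation_def dist_mult_def \<psi>_def[abs_def] case_prod_unfold)
    also have "\<dots> = - (1 / Gamma (1 - \<alpha>)) * integral\<^sup>L (lborel \<Otimes>\<^sub>M lborel) ?J"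
      unfolding U by (rule J(2))
    also have "\<dots> = (\<integral>z. heaviside (snd z) * lap z * \<theta> z \<partial>lborel)
        - (\<integral>z. heaviside (snd z) * utt z * \<phi> z \<partial>lborel)"
      unfolding J_eq using Gamma_pos(1) by simp
    finally have memory: "attenuation a \<alpha> U \<phi> = (\<integral>z. heaviside (snd z) * lap z * \<theta> z \<partial>lborel)
        - (\<integral>z. heaviside (snd z) * utt z * \<phi> z \<partial>lborel)" .
    have source: "dist_tensor (dist_of f) (dist_deriv 1 (dirac 0)) \<phi>
        = (\<integral>x. - (f x * dir_deriv (0, 1) \<phi> (x, 0)) \<partial>lborel)"
      using dir_deriv_1_eq[OF test_function_time_deriv[OF \<phi>]]
      by (simp add: dist_tensor_def dist_of_def dist_deriv_def dirac_def)
    show "dist_dt (dist_dt U) \<phi> - dist_mult (\<lambda>(x, t). (c x)\<^sup>2) (dist_laplacian_x U) \<phi>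
        + attenuation a \<alpha> U \<phi> = dist_tensor (dist_of f) (dist_deriv 1 (dirac 0)) \<phi>"
      unfolding wave_time wave_space memory source by simp
  qed
next
  show "vanishes_on (UNIV \<times> {..<0}) U"
    unfolding vanishes_on_def
  proof (intro allI impI, elim conjE)
    fix \<phi> :: "(real^'n) \<times> real \<Rightarrow> real"
    assume "closure {z. \<phi> z \<noteq> 0} \<subseteq> UNIV \<times> {..<0}"
    then have "\<phi> z = 0 \<or> snd z < 0" for z using closure_subset[of "{z. \<phi> z \<noteq> 0}"] by force
    then have "(case z of (x, t) \<Rightarrow> heaviside t * u x t) * \<phi> z = 0" for z
      using \<open>\<phi> z = 0 \<or> snd z < 0\<close> by (cases z) (auto simp: heaviside_def)
    then show "U \<phi> = 0" unfolding U_def dist_of_def by (simp only: Bochner_Integration.integral_zero)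
  qed
qed

end
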